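(* Let $T_1,\dots,T_k$ be rooted trees and let $T=B_+(T_1,\dots,T_k)$. Then the coefficient of the tree $B_+(T)$ in $\overline{\Omega}_q$ satisfies $$\overline{\Omega}_{q,B_+(T)}=\Psi\Big(-x\prod_{i=1}^k \mathcal{S}_{T_i}\Big).$$
   Context: $q$ and $x$ are indeterminates. A tree is a finite rooted tree (finite connected acyclic graph with a distinguished vertex, the root), considered up to isomorphism. $\#T$ is the number of vertices of $T$, $\mathrm{aut}(T)$ is the order of its automorphism group, $\bullet$ is the one-vertex tree, and $B_+(T_1,\dots,T_k)$ is the tree obtained by grafting $T_1,\dots,T_k$ on a new common root (for $k=0$ this is $\bullet$). A tree series over a commutative $\mathbb{Q}$-algebra $R$ is a formal infinite sum $A=\sum_T A_T\,\frac{T}{\mathrm{aut}(T)}$ over all trees, with $A_T\in R$ (the coefficient of $T$ in $A$); $\bullet$ is also viewed as a tree series. For $\alpha\in R$, $(\Sigma_\alpha A)_T=\alpha^{\#T-1}A_T$. For tree series $A,B$, the tree series $\mathrm{Crls}\diamond(A,B)$ is defined by $$(\mathrm{Crls}\diamond(A,B))_T=\sum_{T_0}A_{T_0}\prod_{T'}B_{T'},$$ where $T_0$ runs over the subtrees (connected sets of vertices) of $T$ containing the root of $T$ (and rooted there), and $T'$ runs over the connected components of the complement of $T_0$ in $T$, each rooted at its vertex closest to the root of $T$ (an empty product is $1$). $\mathcal{S}$ denotes the unique tree series over $\mathbb{Q}(q)[x]$ satisfying $$q\,\Sigma_q \mathcal{S}-\mathrm{Crls}\diamond(\mathcal{S},-\bullet)=q\,(1+(q-1)x)\,\mathrm{Crls}\diamond(\bullet,\,q\,\Sigma_q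 \mathcal{S})-\bullet .$$ $\bullet\curvearrowleft A$ denotes the grafting of $A$ on the one-vertex tree (pre-Lie product): the coefficient of $B_+(T_1)$ in it is $A_{T_1}$, and the coefficient of any tree not of the form $B_+(T_1)$ is $0$. $\Omega_q$ is the tree series over $\mathbb{Q}(q)$ defined by the equation (which determines it uniquely) $$\mathrm{Crls}\diamond(q\,\Sigma_q\Omega_q,\bullet)-\Omega_q=\bullet\curvearrowleft\Omega_q+(q-1)\bullet ,$$ $\Omega_{1/q}$ is obtained from it by replacing $q$ by $1/q$ in all coefficients, and $\overline{\Omega}_q=\Sigma_{(-1/q)}\Omega_{1/q}$. The Bernoulli–Carlitz numbers $\beta_n\in\mathbb{Q}(q)$ are defined by $\beta_0=1$ and $q(q\beta+1)^n-\beta_n=1$ if $n=1$, $=0$ if $n>1$, where after expanding the binomial power each $\beta^k$ is replaced by $\beta_k$. $\Psi:\mathbb{Q}(q)[x]\to\mathbb{Q}(q)$ is the $\mathbb{Q}(q)$-linear form with $\Psi(x^n)=\beta_n$ for all $n\ge0$. *)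

theory Defs
  imports
    "HOL-Library.Multiset"
    "HOL-Computational_Algebra.Computational_Algebra"
    "HOL-Computational_Algebra.Field_as_Ring"
begin

section \<open>Rooted trees and their vertices\<close>

text \<open>
  A finite rooted tree up to isomorphism is determined by the multiset of the branches at its
  root; the one-vertex tree is \<open>B_plus {#}\<close>.
\<close>

datatype rtree = B_plus "rtree multiset"

primrec num_vertices :: "rtree \<Rightarrow> nat" where
  "num_vertices (B_plus Ts) = 1 + sum_mset (image_mset num_vertices Ts)"

text \<open>
  Subtrees of a tree are sets of vertices, so a tree is realised concretely as a finite connected
  vertex set, containing the root \<open>[]\<close>, of the infinite tree on \<open>nat list\<close> in which the children
  of \<open>v\<close> are the \<open>v @ [i]\<close>. The distance of \<open>v\<close> to the root is \<open>length v\<close>.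
\<close>

definition edges :: "(nat list \<times> nat list) set" where
  "edges = {(v, w). \<exists>i. w = v @ [i] \<or> v = w @ [i]}"

definition reachable_in :: "nat list set \<Rightarrow> (nat list \<times> nat list) set" where
  "reachable_in S = (Restr edges S)\<^sup>*"

definition connected_vertices :: "nat list set \<Rightarrow> bool" where
  "connected_vertices S \<longleftrightarrow> (\<forall>v\<in>S. \<forall>w\<in>S. (v, w) \<in> reachable_in S)"

definition components_of :: "nat list set \<Rightarrow> nat list set set" where
  "components_of S = S // reachable_in S"

definition top_vertex :: "nat list set \<Rightarrow> nat list" where
  "top_vertex C = (ARG_MIN length v. v \<in> C)"

text \<open>
  \<open>shape S v\<close> is the isomorphism class of the tree formed by those vertices of \<open>S\<close> that are
  reached from \<open>v\<close> by moving away from \<open>[]\<close> inside \<open>S\<close>, rooted at \<open>v\<close>; for connected \<open>S\<close> with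
  top vertex \<open>v\<close> this is all of \<open>S\<close>. The value for infinite \<open>S\<close> is irrelevant.
\<close>

function shape :: "nat list set \<Rightarrow> nat list \<Rightarrow> rtree" where
  "shape S v = (if finite S
     then B_plus (image_mset (\<lambda>w. shape S w) (mset_set {w \<in> S. \<exists>i. w = v @ [i]}))
     else B_plus {#})"
  by auto
termination
proof (relation "measure (\<lambda>(S, v). card {w \<in> S. length v < length w})", goal_cases)
  case (2 S v w)
  have "finite {w \<in> S. \<exists>i. w = v @ [i]}" using 2(1) by (rule finite_subset[rotated]) blast
  with 2(2) have "w \<in> {w \<in> S. \<exists>i. w = v @ [i]}" by (simp only: elem_mset_set)
  then obtain i where w: "w \<in> S" "w = v @ [i]" by blast
  then have len: "length w = Suc (length v)" by simp
  have "{u \<in> S. length w < length u} \<subset> {u \<in> S. length v < length u}"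
  proof
    show "{u \<in> S. length w < length u} \<subseteq> {u \<in> S. length v < length u}"
      unfolding len by (blast intro: Suc_lessD)
    have "w \<in> {u \<in> S. length v < length u}" "w \<notin> {u \<in> S. length w < length u}"
      using w(1) by (simp_all add: len)
    then show "{u \<in> S. length w < length u} \<noteq> {u \<in> S. length v < length u}"
      by metis
  qed
  then have "card {u \<in> S. length w < length u} < card {u \<in> S. length v < length u}"
    using 2(1) by (intro psubset_card_mono) simp_all
  then show ?case by (simp only: in_measure prod.case)
qed (rule wf_measure)

declare shape.simps [simp del]

definition realises :: "nat list set \<Rightarrow> rtree \<Rightarrow> bool" where
  "realises S T \<longleftrightarrow> finite S \<and> [] \<in> S \<and> connected_vertices S \<and> shape S [] = T"

lemma shape_branch:
  assumes "finite S" "finite S'" "\<And>w. i # w \<in> S \<longleftrightarrow> w \<in> S'"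
  shows "shape S (i # v) = shape S' v"
  using assms
proof (induction S' v arbitrary: S rule: shape.induct)
  case (1 S' v)
  have eq: "{w \<in> S. \<exists>j. w = (i # v) @ [j]} = (#) i ` {w \<in> S'. \<exists>j. w = v @ [j]}"
    using 1(4) by auto
  have ms: "mset_set {w \<in> S. \<exists>j. w = (i # v) @ [j]}
      = image_mset ((#) i) (mset_set {w \<in> S'. \<exists>j. w = v @ [j]})"
    unfolding eq by (rule image_mset_mset_set [symmetric]) simp
  have IH: "shape S (i # w) = shape S' w"
    if "w \<in># mset_set {w \<in> S'. \<exists>j. w = v @ [j]}" for w
    using 1(1)[OF 1(3) that 1(2,3,4)] .
  have "shape S (i # v)
      = B_plus (image_mset (shape S) (mset_set {w \<in> S. \<exists>j. w = (i # v) @ [j]}))"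
    using 1(2) by (subst shape.simps) (rule if_P)
  also have "\<dots> = B_plus (image_mset (\<lambda>w. shape S (i # w)) (mset_set {w \<in> S'. \<exists>j. w = v @ [j]}))"
    unfolding ms multiset.map_comp comp_def ..
  also have "\<dots> = B_plus (image_mset (shape S') (mset_set {w \<in> S'. \<exists>j. w = v @ [j]}))"
    by (rule arg_cong[of _ _ B_plus], rule image_mset_cong, rule IH)
  also have "\<dots> = shape S' v"
    using 1(3) by (subst shape.simps) (rule if_P[symmetric])
  finally show ?case .
qed

lemma reachable_in_Cons:
  assumes "(v, w) \<in> reachable_in S'" "(#) i ` S' \<subseteq> S"
  shows "(i # v, i # w) \<in> reachable_in S"
  using assms(1) unfolding reachable_in_def
proof (induction rule: rtrancl_induct)
  case (step y z)
  then have "(i # y, i # z) \<in> Restr edges S"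
    using assms(2) by (auto simp: edges_def)
  with step show ?case by (meson rtrancl_into_rtrancl)
qed simp

lemma sym_reachable_in: "(v, w) \<in> reachable_in S \<Longrightarrow> (w, v) \<in> reachable_in S"
  unfolding reachable_in_def
  by (rule symD[OF sym_rtrancl]) (auto simp: sym_def edges_def)

lemma ex_realisation: "\<exists>S. realises S T"
proof (induction T)
  case (B_plus M)
  obtain xs where xs: "mset xs = M" by (meson ex_mset)
  have "\<forall>i<length xs. \<exists>S. realises S (xs ! i)"
    using B_plus xs by (metis nth_mem_mset)
  then obtain f where f: "\<And>i. i < length xs \<Longrightarrow> realises (f i) (xs ! i)"
    by metis
  define S where "S = insert [] (\<Union>i<length xs. (#) i ` f i)"
  have fin: "finite S" unfolding S_def using f by (auto simp: realises_def)
  have mem: "i # w \<in> S \<longleftrightarrow> w \<in> f i" if "i < length xs" for i w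
    using that by (auto simp: S_def)
  have "([], v) \<in> reachable_in S" if "v \<in> S" for v
  proof (cases v)
    case Nil
    then show ?thesis by (simp add: reachable_in_def)
  next
    case (Cons i w)
    with that have i: "i < length xs" and w: "w \<in> f i" by (auto simp: S_def)
    have "([], w) \<in> reachable_in (f i)"
      using f[OF i] w by (auto simp: realises_def connected_vertices_def)
    then have "([i], i # w) \<in> reachable_in S"
      by (rule reachable_in_Cons) (use i in \<open>auto simp: S_def\<close>)
    moreover have "([], [i]) \<in> Restr edges S"
      using f[OF i] i by (auto simp: S_def realises_def edges_def)
    ultimately show ?thesis
      unfolding Cons reachable_in_def by (meson converse_rtrancl_into_rtrancl)
  qed
  then have conn: "connected_vertices S"
    unfolding connected_vertices_def
    using sym_reachable_in[of "[]" _ S] rtrancl_trans[of _ _ "Restr edges S"]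
    unfolding reachable_in_def by blast
  have ch: "{w \<in> S. \<exists>j. w = [] @ [j]} = (\<lambda>i. [i]) ` {..<length xs}"
    using f by (auto simp: S_def realises_def)
  have "image_mset (shape S) (mset_set {w \<in> S. \<exists>j. w = [] @ [j]})
      = image_mset (\<lambda>i. shape S [i]) (mset_set {..<length xs})"
    unfolding ch by (subst image_mset_mset_set [symmetric]) (auto simp: inj_on_def multiset.map_comp comp_def)
  also have "\<dots> = image_mset (\<lambda>i. xs ! i) (mset_set {..<length xs})"
  proof (rule image_mset_cong)
    fix i assume "i \<in># mset_set {..<length xs}"
    then have i: "i < length xs" by simp
    show "shape S [i] = xs ! i"
      using f[OF i] shape_branch[OF fin _ mem[OF i], of "[]"] by (simp add: realises_def)
  qed
  also have "\<dots> = M"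
    using arg_cong[OF map_nth[of xs], of mset] xs
    by (simp only: mset_map mset_upt atLeast0LessThan)
  finally have "shape S [] = B_plus M"
    using fin by (subst shape.simps) simp
  then show ?case
    using fin conn unfolding realises_def by (intro exI[of _ S] conjI) (simp_all add: S_def)
qed

definition vertices :: "rtree \<Rightarrow> nat list set" where
  "vertices T = (SOME S. realises S T)"

lemma realises_vertices: "realises (vertices T) T"
  unfolding vertices_def by (rule someI_ex) (rule ex_realisation)


section \<open>Tree series\<close>

text \<open>
  A tree series is given by its coefficients \<open>A T\<close> with respect to \<open>T / aut T\<close>, that is,
  \<open>A\<close> stands for the formal sum of the \<open>A T * (T / aut T)\<close>.
\<close>

type_synonym 'a tree_series = "rtree \<Rightarrow> 'a"

definition bullet :: "'a::comm_ring_1 tree_series" where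
  "bullet T = (if T = B_plus {#} then 1 else 0)"

definition Sigma_series :: "'a::comm_ring_1 \<Rightarrow> 'a tree_series \<Rightarrow> 'a tree_series" where
  "Sigma_series \<alpha> A T = \<alpha> ^ (num_vertices T - 1) * A T"

definition Crls_diamond ::
    "'a::comm_ring_1 tree_series \<Rightarrow> 'a tree_series \<Rightarrow> 'a tree_series" where
  "Crls_diamond A B T =
     (\<Sum>S | S \<subseteq> vertices T \<and> [] \<in> S \<and> connected_vertices S.
        A (shape S []) * (\<Prod>C\<in>components_of (vertices T - S). B (shape C (top_vertex C))))"

definition graft_on_bullet :: "'a::comm_ring_1 tree_series \<Rightarrow> 'a tree_series" where
  "graft_on_bullet A T =
     (if \<exists>T1. T = B_plus {#T1#} then A (THE T1. T = B_plus {#T1#}) else 0)"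


section \<open>The coefficient ring and the particular series\<close>

type_synonym Qq = "rat poly fract"

definition qvar :: Qq where
  "qvar = to_fract [:0, 1:]"

text \<open>In \<open>Qq poly\<close> the polynomial variable is \<open>x\<close>.\<close>

definition xvar :: "Qq poly" where
  "xvar = [:0, 1:]"

definition eval_rat_poly :: "rat poly \<Rightarrow> Qq \<Rightarrow> Qq" where
  "eval_rat_poly p a = poly (map_poly (\<lambda>c. to_fract [:c:]) p) a"

text \<open>The substitution of \<open>1/q\<close> for \<open>q\<close> in a rational function.\<close>

definition invert_q :: "Qq \<Rightarrow> Qq" where
  "invert_q f = (case quot_of_fract f of (a, b) \<Rightarrow>
     eval_rat_poly a (1 / qvar) / eval_rat_poly b (1 / qvar))"

definition S_series :: "Qq poly tree_series" where
  "S_series = (THE S.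
     \<forall>T. [:qvar:] * Sigma_series [:qvar:] S T - Crls_diamond S (\<lambda>T'. - bullet T') T
       = [:qvar:] * (1 + [:qvar - 1:] * xvar)
           * Crls_diamond bullet (\<lambda>T'. [:qvar:] * Sigma_series [:qvar:] S T') T
         - bullet T)"

definition Omega_q :: "Qq tree_series" where
  "Omega_q = (THE \<Omega>.
     \<forall>T. Crls_diamond (\<lambda>T'. qvar * Sigma_series qvar \<Omega> T') bullet T - \<Omega> T
       = graft_on_bullet \<Omega> T + (qvar - 1) * bullet T)"

definition Omega_bar :: "Qq tree_series" where
  "Omega_bar = Sigma_series (- 1 / qvar) (\<lambda>T. invert_q (Omega_q T))"

definition Bernoulli_Carlitz :: "nat \<Rightarrow> Qq" where
  "Bernoulli_Carlitz = (THE b. b 0 = 1 \<and>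
     (\<forall>n\<ge>1. qvar * (\<Sum>k\<le>n. of_nat (n choose k) * qvar ^ k * b k) - b n
        = (if n = 1 then 1 else 0)))"

definition Psi :: "Qq poly \<Rightarrow> Qq" where
  "Psi p = (\<Sum>n\<le>degree p. coeff p n * Bernoulli_Carlitz n)"

end

(* The value of S_T at the q-integer [n] = (q^n - 1) / (q - 1) is the q-count of order preserving
   maps from T to {0..n}. Two consequences are proved algebraically: S_T vanishes at [-1] = -1/q,
   and the difference of S_T under [n] -> [n + 1] is, up to an explicit factor, the shifted product
   of the series of the branches of T. Differentiating the equation of S at -1/q gives the equation
   of Omega_bar, so the coefficient of T in Omega_bar is the derivative of S_T at -1/q divided by q.
   A q-analogue of the Euler-Maclaurin formula turns this derivative, for B_+(T), into Psi(S_T), and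
   a summation by parts turns Psi(S_T) into the stated value. *)
theory Submission
  imports Defs "HOL-Library.Sublist" "HOL-Library.FuncSet" "HOL-Library.Poly_Mapping"
    "HOL-Library.Product_Plus"
begin

section \<open>Rooted subtrees and their complements\<close>

text \<open>The obstacle is \<open>Crls_diamond\<close>: it sums over the vertex sets of a
  realisation picked by \<open>SOME\<close>, and a branch of that realisation need not be the one
  picked for its own shape, so independence of the choice has to be proved. After that, three
  properties carry the argument: factorisation over the branches when the first series is
  multiplicative in them; triangularity, the coefficient at \<open>T\<close> being that of the first
  series plus terms from smaller trees; and, for second argument \<open>bullet\<close> or
  \<open>- bullet\<close>, compatibility with every additive map of coefficients. The last one lets
  evaluation, differentiation and shift be applied directly to the equation of
  \<open>S_series\<close>. Triangularity gives these equations the pivot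
  \<open>qvar ^ num_vertices T - 1\<close>, so that two series obeying the same equation agree. The
  point -1/q is singled out both as the preimage of 0 under [n] -> [n + 1] and as the zero of q (1 +
  (q - 1) x) - 1, the right-hand side of the equation at the one-vertex tree.\<close>

definition prefix_closed :: "nat list set \<Rightarrow> bool" where
  "prefix_closed S \<longleftrightarrow> (\<forall>v i. v @ [i] \<in> S \<longrightarrow> v \<in> S)"

definition vertex_tree :: "nat list set \<Rightarrow> bool" where
  "vertex_tree V \<longleftrightarrow> finite V \<and> [] \<in> V \<and> prefix_closed V"

definition branch :: "nat \<Rightarrow> nat list set \<Rightarrow> nat list set" where
  "branch i S = {w. i # w \<in> S}"

definition heads :: "nat list set \<Rightarrow> nat set" where
  "heads S = {i. [i] \<in> S}"

definition descendants :: "nat list set \<Rightarrow> nat list \<Rightarrow> nat list set" where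
  "descendants V v = {w \<in> V. prefix v w}"

text \<open>These are the top vertices of the components of \<open>V - S\<close>. The clause
  \<open>v = []\<close> serves the empty \<open>S\<close>, for which all of \<open>V\<close> is one
  component.\<close>

definition frontier :: "nat list set \<Rightarrow> nat list set \<Rightarrow> nat list set" where
  "frontier V S = {v \<in> V - S. v = [] \<or> butlast v \<in> S}"

definition rooted_subtrees :: "nat list set \<Rightarrow> nat list set set" where
  "rooted_subtrees V = {S. S \<subseteq> V \<and> [] \<in> S \<and> prefix_closed S}"

text \<open>This is \<open>Crls_diamond\<close> over an arbitrary realisation, so that it can be
  restricted to the branches of a vertex set.\<close>

definition Crls_on ::
    "nat list set \<Rightarrow> 'a::comm_ring_1 tree_series \<Rightarrow> 'a tree_series \<Rightarrow> 'a" where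
  "Crls_on V A B =
     (\<Sum>S\<in>rooted_subtrees V. A (shape S []) * (\<Prod>v\<in>frontier V S. B (shape V v)))"

lemma prefix_closedD: "prefix_closed S \<Longrightarrow> prefix u v \<Longrightarrow> v \<in> S \<Longrightarrow> u \<in> S"
proof (induction v rule: rev_induct)
  case (snoc i v)
  then show ?case by (auto simp: prefix_closed_def)
qed simp

lemma prefix_closed_Nil: "prefix_closed S \<Longrightarrow> S \<noteq> {} \<Longrightarrow> [] \<in> S"
  by (metis ex_in_conv prefix_closedD Nil_prefix)

text \<open>An edge adds or removes one last letter, so a walk from \<open>[]\<close> inside
  \<open>S\<close> meets every prefix of each vertex that it reaches; conversely the prefixes of a
  vertex form a walk.\<close>

lemma connected_vertices_iff_prefix_closed:
  assumes "[] \<in> S"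
  shows "connected_vertices S \<longleftrightarrow> prefix_closed S"
proof
  assume conn: "connected_vertices S"
  have *: "\<forall>u. prefix u w \<longrightarrow> u \<in> S" if "([], w) \<in> reachable_in S" for w
    using that unfolding reachable_in_def
  proof (induction rule: rtrancl_induct)
    case base
    then show ?case using assms by simp
  next
    case (step y z)
    then show ?case by (auto simp: edges_def)
  qed
  show "prefix_closed S"
    unfolding prefix_closed_def
  proof (intro allI impI)
    fix v i assume "v @ [i] \<in> S"
    then have "([], v @ [i]) \<in> reachable_in S"
      using conn assms by (auto simp: connected_vertices_def)
    with * show "v \<in> S" by (meson prefixI)
  qed
next
  assume pc: "prefix_closed S"
  have *: "([], v) \<in> reachable_in S" if "v \<in> S" for v
    using that
  proof (induction v rule: rev_induct)
    case Nil
    then show ?case by (simp add: reachable_in_def)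
  next
    case (snoc i v)
    then have "v \<in> S" using pc by (auto simp: prefix_closed_def)
    then have "(v, v @ [i]) \<in> Restr edges S" "([], v) \<in> reachable_in S"
      using snoc by (auto simp: edges_def)
    then show ?case unfolding reachable_in_def by (meson rtrancl_into_rtrancl)
  qed
  show "connected_vertices S"
    unfolding connected_vertices_def
  proof (intro ballI)
    fix v w assume "v \<in> S" "w \<in> S"
    then have "(v, []) \<in> reachable_in S" "([], w) \<in> reachable_in S"
      by (auto intro: * sym_reachable_in[OF *])
    then show "(v, w) \<in> reachable_in S"
      unfolding reachable_in_def by (rule rtrancl_trans)
  qed
qed

lemma vertex_tree_vertices: "vertex_tree (vertices T)"
  and shape_vertices: "shape (vertices T) [] = T"
proof -
  show "vertex_tree (vertices T)"
    using realises_vertices[of T] connected_vertices_iff_prefix_closed[of "vertices T"]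
    unfolding realises_def vertex_tree_def by blast
  show "shape (vertices T) [] = T"
    using realises_vertices[of T] unfolding realises_def by blast
qed

lemma shape_descendants:
  assumes "finite V" "prefix t v"
  shows "shape (descendants V t) v = shape V v"
  using assms
proof (induction V v rule: shape.induct)
  case (1 V v)
  have fin: "finite (descendants V t)" using 1(2) by (simp add: descendants_def)
  have eq: "{w \<in> descendants V t. \<exists>i. w = v @ [i]} = {w \<in> V. \<exists>i. w = v @ [i]}"
    using 1(3) by (auto simp: descendants_def)
  have "image_mset (shape (descendants V t)) (mset_set {w \<in> V. \<exists>i. w = v @ [i]})
      = image_mset (shape V) (mset_set {w \<in> V. \<exists>i. w = v @ [i]})"
  proof (rule image_mset_cong)
    fix w assume w: "w \<in># mset_set {w \<in> V. \<exists>i. w = v @ [i]}"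
    have "prefix t w" using w 1(2,3) by auto
    show "shape (descendants V t) w = shape V w"
      by (rule "1.IH"[OF 1(2) w 1(2) \<open>prefix t w\<close>])
  qed
  then show ?case
    unfolding shape.simps[of "descendants V t" v] shape.simps[of V v]
    using 1(2) fin by (simp add: eq)
qed

text \<open>Climbing from a vertex outside \<open>S\<close> ends at a frontier vertex. A walk in
  \<open>V - S\<close> cannot leave the descendants of that vertex, because its parent, if any, lies
  in \<open>S\<close>.\<close>

lemma components_of_complement:
  assumes V: "vertex_tree V" and S: "S \<in> rooted_subtrees V"
  shows "components_of (V - S) = descendants V ` frontier V S"
proof -
  have pc: "prefix_closed S" "[] \<in> S" "prefix_closed V"
    using V S by (auto simp: rooted_subtrees_def vertex_tree_def)
  have ex: "\<exists>t\<in>frontier V S. v \<in> descendants V t" if "v \<in> V - S" for v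
    using that
  proof (induction v rule: rev_induct)
    case Nil
    then show ?case using pc by simp
  next
    case (snoc i v)
    show ?case
    proof (cases "v \<in> S")
      case True
      then have "v @ [i] \<in> frontier V S" using snoc by (auto simp: frontier_def)
      then show ?thesis using snoc by (auto simp: descendants_def)
    next
      case False
      then have "v \<in> V - S" using pc snoc by (auto simp: prefix_closed_def)
      then show ?thesis using snoc by (force simp: descendants_def)
    qed
  qed
  have reach: "(t, w) \<in> reachable_in (V - S)" if "t \<in> frontier V S" "w \<in> descendants V t" for t w
    using that(2)
  proof (induction w rule: rev_induct)
    case Nil
    then show ?case by (simp add: descendants_def reachable_in_def)
  next
    case (snoc i w)
    show ?case
    proof (cases "t = w @ [i]")
      case True
      then show ?thesis by (simp add: reachable_in_def)
    next
      case False
      then have t: "prefix t w" using snoc by (auto simp: descendants_def)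
      then have w: "w \<in> descendants V t"
        using snoc pc by (auto simp: descendants_def prefix_closed_def)
      have "w \<notin> S" "w @ [i] \<notin> S"
        using that(1) t prefix_closedD[OF pc(1), of t w] prefix_closedD[OF pc(1), of t "w @ [i]"]
        by (auto simp: frontier_def)
      then have "(w, w @ [i]) \<in> Restr edges (V - S)"
        using w snoc by (auto simp: edges_def descendants_def)
      then show ?thesis
        using snoc.IH[OF w] unfolding reachable_in_def by (meson rtrancl_into_rtrancl)
    qed
  qed
  have closed: "w \<in> descendants V t"
    if t: "t \<in> frontier V S" and "v \<in> descendants V t" "(v, w) \<in> reachable_in (V - S)" for t v w
    using that(3,2) unfolding reachable_in_def
  proof (induction rule: rtrancl_induct)
    case (step y z)
    then have y: "prefix t y" and z: "z \<in> V - S" and yz: "(y, z) \<in> edges"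
      by (auto simp: descendants_def)
    have "prefix t z"
    proof (cases "\<exists>i. z = y @ [i]")
      case True
      then show ?thesis using y by (auto intro: prefix_prefix)
    next
      case False
      then obtain i where i: "y = z @ [i]" using yz by (auto simp: edges_def)
      \<comment> \<open>Moving up from \<open>t\<close> itself would lead to its parent, which is in
        \<open>S\<close>, whereas \<open>z\<close> is not.\<close>
      have "t \<noteq> y" using t z i by (auto simp: frontier_def)
      then show ?thesis using y i by auto
    qed
    then show ?case using z by (auto simp: descendants_def)
  qed
  have cls: "reachable_in (V - S) `` {v} = descendants V t"
    if "t \<in> frontier V S" "v \<in> descendants V t" for t v
  proof
    show "reachable_in (V - S) `` {v} \<subseteq> descendants V t"
      by (auto intro: closed[OF that])
    show "descendants V t \<subseteq> reachable_in (V - S) `` {v}"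
    proof
      fix w assume "w \<in> descendants V t"
      then have "(t, w) \<in> reachable_in (V - S)" by (rule reach[OF that(1)])
      moreover have "(v, t) \<in> reachable_in (V - S)"
        by (rule sym_reachable_in) (rule reach[OF that])
      ultimately show "w \<in> reachable_in (V - S) `` {v}"
        unfolding reachable_in_def by (auto intro: rtrancl_trans[of v t])
    qed
  qed
  have self: "t \<in> V - S \<and> t \<in> descendants V t" if "t \<in> frontier V S" for t
    using that by (auto simp: frontier_def descendants_def)
  show ?thesis
    unfolding components_of_def quotient_def
  proof (intro equalityI subsetI)
    fix C assume "C \<in> (\<Union>v\<in>V - S. {reachable_in (V - S) `` {v}})"
    then obtain v where v: "v \<in> V - S" "C = reachable_in (V - S) `` {v}" by auto
    from ex[OF v(1)] obtain t where t: "t \<in> frontier V S" "v \<in> descendants V t" by (elim bexE)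
    then show "C \<in> descendants V ` frontier V S" using cls[OF t] v(2) by simp
  next
    fix C assume "C \<in> descendants V ` frontier V S"
    then obtain t where t: "t \<in> frontier V S" "C = descendants V t" by auto
    then have "C = reachable_in (V - S) `` {t}" using cls[OF t(1)] self[OF t(1)] by simp
    with self[OF t(1)] show "C \<in> (\<Union>v\<in>V - S. {reachable_in (V - S) `` {v}})"
      by (intro UN_I[of t]) simp_all
  qed
qed

lemma top_vertex_descendants:
  assumes "t \<in> V"
  shows "top_vertex (descendants V t) = t"
proof -
  have t: "t \<in> descendants V t" using assms by (simp add: descendants_def)
  have "is_arg_min length (\<lambda>v. v \<in> descendants V t) (top_vertex (descendants V t))"
    unfolding top_vertex_def arg_min_def
    by (rule someI[of _ t]) (use t in \<open>auto simp: is_arg_min_def descendants_def not_less prefix_length_le\<close>)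
  then have "prefix t (top_vertex (descendants V t))"
    "length (top_vertex (descendants V t)) \<le> length t"
    using t by (auto simp: is_arg_min_def descendants_def not_less)
  then show ?thesis by (auto simp: prefix_def)
qed

lemma Crls_diamond_eq_Crls_on: "Crls_diamond A B T = Crls_on (vertices T) A B"
proof -
  let ?V = "vertices T"
  have V: "vertex_tree ?V" by (rule vertex_tree_vertices)
  have eq: "{S. S \<subseteq> ?V \<and> [] \<in> S \<and> connected_vertices S} = rooted_subtrees ?V"
    using connected_vertices_iff_prefix_closed by (auto simp: rooted_subtrees_def)
  have "(\<Prod>C\<in>components_of (?V - S). B (shape C (top_vertex C)))
      = (\<Prod>v\<in>frontier ?V S. B (shape ?V v))" if "S \<in> rooted_subtrees ?V" for S
  proof -
    have inj: "inj_on (descendants ?V) (frontier ?V S)"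
      by (rule inj_on_inverseI[of _ top_vertex]) (auto simp: frontier_def top_vertex_descendants)
    show ?thesis
      unfolding components_of_complement[OF V that] prod.reindex[OF inj] comp_def
      using V by (intro prod.cong)
        (auto simp: frontier_def top_vertex_descendants shape_descendants vertex_tree_def)
  qed
  then show ?thesis
    unfolding Crls_diamond_def eq Crls_on_def by (intro sum.cong) simp_all
qed

section \<open>Factorisation over the branches at the root\<close>

lemma finite_branch: "finite S \<Longrightarrow> finite (branch i S)"
  unfolding branch_def by (rule finite_subset[of _ "tl ` S"]) force+

lemma finite_heads: "finite S \<Longrightarrow> finite (heads S)"
  unfolding heads_def by (rule finite_subset[of _ "hd ` S"]) force+

lemma prefix_closed_branch: "prefix_closed S \<Longrightarrow> prefix_closed (branch i S)"
  by (force simp: prefix_closed_def branch_def)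

lemma vertex_tree_branch: "vertex_tree V \<Longrightarrow> i \<in> heads V \<Longrightarrow> vertex_tree (branch i V)"
  using finite_branch prefix_closed_branch by (auto simp: vertex_tree_def heads_def branch_def)

lemma shape_Cons: "finite S \<Longrightarrow> shape S (i # v) = shape (branch i S) v"
  by (rule shape_branch) (auto simp: branch_def intro: finite_branch[unfolded branch_def])

lemma shape_Nil:
  assumes "finite S"
  shows "shape S [] = B_plus (image_mset (\<lambda>i. shape (branch i S) []) (mset_set (heads S)))"
proof -
  have "{w \<in> S. \<exists>i. w = [] @ [i]} = (\<lambda>i. [i]) ` heads S" by (auto simp: heads_def)
  then have "image_mset (shape S) (mset_set {w \<in> S. \<exists>i. w = [] @ [i]})
      = image_mset (\<lambda>i. shape S [i]) (mset_set (heads S))"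
    by (simp add: image_mset_mset_set [symmetric] inj_on_def multiset.map_comp comp_def)
  then show ?thesis
    using assms by (subst shape.simps) (simp add: shape_Cons)
qed

text \<open>A rooted subtree is the root together with independent choices of a prefix-closed set in
  each branch. An empty choice cuts off the whole branch and contributes the \<open>B\<close> term;
  a nonempty one is a rooted subtree of the branch and contributes to \<open>Crls_on\<close> with
  \<open>a\<close>.\<close>

lemma Crls_on_factor:
  fixes a A B :: "'a::comm_ring_1 tree_series"
  assumes V: "vertex_tree V" and A: "\<And>M. A (B_plus M) = prod_mset (image_mset a M)"
  shows "Crls_on V A B = (\<Prod>i\<in>heads V. B (shape (branch i V) []) + Crls_on (branch i V) a B)"
proof -
  have fin: "finite V" and pc: "prefix_closed V" using V by (auto simp: vertex_tree_def)
  define X where "X i = {S. S \<subseteq> branch i V \<and> prefix_closed S}" for i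
  define f where "f i S = (if S = {} then 1 else a (shape S []))
    * (\<Prod>v\<in>frontier (branch i V) S. B (shape (branch i V) v))" for i S
  have X: "X i = insert {} (rooted_subtrees (branch i V))" for i
    using prefix_closed_Nil by (auto simp: X_def rooted_subtrees_def prefix_closed_def)
  have finX: "finite (X i)" for i
    using finite_branch[OF fin, of i] by (simp add: X_def)
  have factor: "B (shape (branch i V) []) + Crls_on (branch i V) a B = (\<Sum>S\<in>X i. f i S)"
    if "i \<in> heads V" for i
  proof -
    have "{} \<notin> rooted_subtrees (branch i V)" by (auto simp: rooted_subtrees_def)
    moreover have "frontier (branch i V) {} = {[]}"
      using that by (auto simp: frontier_def heads_def branch_def)
    moreover have "finite (rooted_subtrees (branch i V))"
      using finX[of i] by (simp add: X)
    moreover have "(\<Sum>S\<in>rooted_subtrees (branch i V). f i S) = Crls_on (branch i V) a B"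
      unfolding Crls_on_def by (intro sum.cong) (auto simp: f_def rooted_subtrees_def)
    ultimately show ?thesis
      by (simp add: X) (simp add: f_def)
  qed
  define glue where "glue g = insert [] (\<Union>i\<in>heads V. (#) i ` g i)" for g :: "nat \<Rightarrow> nat list set"
  \<comment> \<open>The restriction makes \<open>cut S\<close> extensional, as membership in
    \<open>PiE\<close> demands.\<close>
  define cut where "cut S = restrict (\<lambda>i. branch i S) (heads V)" for S
  have "(\<Prod>i\<in>heads V. B (shape (branch i V) []) + Crls_on (branch i V) a B)
      = (\<Prod>i\<in>heads V. \<Sum>S\<in>X i. f i S)"
    using factor by (intro prod.cong) auto
  also have "\<dots> = (\<Sum>g\<in>PiE (heads V) X. \<Prod>i\<in>heads V. f i (g i))"
    using finX finite_heads[OF fin] by (intro prod_sum_PiE)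
  also have "\<dots> = Crls_on V A B"
    unfolding Crls_on_def
  proof (rule sum.reindex_bij_witness[of _ cut glue])
    fix g assume g: "g \<in> PiE (heads V) X"
    have br: "branch i (glue g) = g i" if "i \<in> heads V" for i
      using that by (auto simp: glue_def branch_def)
    show "cut (glue g) = g"
      unfolding cut_def using br g by (intro ext) (auto simp: restrict_def PiE_def extensional_def)
    have sub: "g i \<subseteq> branch i V" "prefix_closed (g i)" if "i \<in> heads V" for i
      using g that by (auto simp: X_def PiE_def Pi_def)
    have "glue g \<subseteq> V"
      using sub V by (fastforce simp: glue_def branch_def vertex_tree_def)
    moreover have "prefix_closed (glue g)"
      unfolding prefix_closed_def
    proof (intro allI impI)
      fix v j assume *: "v @ [j] \<in> glue g"
      show "v \<in> glue g"
      proof (cases v)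
        case (Cons i w)
        with * have "i \<in> heads V" "w @ [j] \<in> g i" by (auto simp: glue_def)
        then show ?thesis
          using sub(2)[of i] Cons by (auto simp: glue_def prefix_closed_def)
      qed (simp add: glue_def)
    qed
    ultimately show glue: "glue g \<in> rooted_subtrees V"
      by (simp add: rooted_subtrees_def glue_def)
    have hd: "heads (glue g) = {i \<in> heads V. g i \<noteq> {}}"
      using prefix_closed_Nil sub by (fastforce simp: heads_def glue_def)
    have fing: "finite (glue g)" using \<open>glue g \<subseteq> V\<close> fin finite_subset by blast
    have "A (shape (glue g) []) = (\<Prod>i\<in>heads (glue g). a (shape (g i) []))"
      unfolding shape_Nil[OF fing] A multiset.map_comp comp_def
      using br hd by (subst prod_unfold_prod_mset[symmetric]) (auto intro!: prod.cong)
    also have "\<dots> = (\<Prod>i\<in>heads V. if g i = {} then 1 else a (shape (g i) []))"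
      using finite_heads[OF fin] unfolding hd by (intro prod.mono_neutral_cong_left) auto
    finally have 1: "A (shape (glue g) []) = \<dots>" .
    have fr: "frontier V (glue g) = (\<Union>i\<in>heads V. (#) i ` frontier (branch i V) (g i))"
    proof (intro equalityI subsetI)
      fix v assume v: "v \<in> frontier V (glue g)"
      then obtain i w where iw: "v = i # w" by (cases v) (auto simp: frontier_def glue_def)
      have "v \<in> V" using v by (simp add: frontier_def)
      then have i: "i \<in> heads V"
        using prefix_closedD[OF pc, of "[i]" v] iw by (auto simp: heads_def)
      then have "w \<in> frontier (branch i V) (g i)"
        using v iw by (auto simp: frontier_def glue_def branch_def split: if_splits)
      with i iw show "v \<in> (\<Union>i\<in>heads V. (#) i ` frontier (branch i V) (g i))" by auto
    next
      fix v assume "v \<in> (\<Union>i\<in>heads V. (#) i ` frontier (branch i V) (g i))"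
      then show "v \<in> frontier V (glue g)"
        by (force simp: frontier_def glue_def branch_def)
    qed
    have "(\<Prod>v\<in>frontier V (glue g). B (shape V v))
        = (\<Prod>i\<in>heads V. \<Prod>v\<in>(#) i ` frontier (branch i V) (g i). B (shape V v))"
      unfolding fr
      by (rule prod.UNION_disjoint)
        (use finite_heads[OF fin] finite_branch[OF fin] in \<open>auto simp: frontier_def\<close>)
    also have "\<dots> = (\<Prod>i\<in>heads V. \<Prod>v\<in>frontier (branch i V) (g i). B (shape (branch i V) v))"
      by (rule prod.cong[OF refl]) (simp add: prod.reindex shape_Cons[OF fin])
    finally show "A (shape (glue g) []) * (\<Prod>v\<in>frontier V (glue g). B (shape V v))
        = (\<Prod>i\<in>heads V. f i (g i))"
      unfolding 1 by (simp add: f_def prod.distrib)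
  next
    fix S assume S: "S \<in> rooted_subtrees V"
    then have pcS: "prefix_closed S" "S \<subseteq> V" "[] \<in> S" by (auto simp: rooted_subtrees_def)
    show "glue (cut S) = S"
    proof (rule set_eqI)
      fix v
      show "v \<in> glue (cut S) \<longleftrightarrow> v \<in> S"
      proof (cases v)
        case (Cons i w)
        have "i \<in> heads V" if "v \<in> S"
          using prefix_closedD[OF pcS(1), of "[i]" v] pcS(2) Cons that by (auto simp: heads_def)
        then show ?thesis using Cons by (auto simp: glue_def cut_def branch_def)
      qed (use pcS in \<open>simp add: glue_def\<close>)
    qed
    show "cut S \<in> PiE (heads V) X"
      using pcS prefix_closed_branch by (auto simp: cut_def X_def branch_def)
  qed
  finally show ?thesis ..
qed

section \<open>Independence of the chosen realisation\<close>

primrec branches :: "rtree \<Rightarrow> rtree multiset" where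
  "branches (B_plus M) = M"

text \<open>These are the admissible cuts of the Connes-Kreimer coproduct with nonempty trunk: pairs
  of trunk and pruned forest, counted with multiplicity.\<close>

definition cuts :: "nat list set \<Rightarrow> (rtree \<times> rtree multiset) multiset" where
  "cuts V = image_mset (\<lambda>S. (shape S [], image_mset (shape V) (mset_set (frontier V S))))
     (mset_set (rooted_subtrees V))"

lemma Crls_on_eq_cuts:
  "Crls_on V A B = (\<Sum>(T, N)\<in>#cuts V. A T * prod_mset (image_mset B N))"
  by (simp add: Crls_on_def cuts_def sum_unfold_sum_mset prod_unfold_prod_mset
      multiset.map_comp comp_def)

lemma single_prod_mset:
  "prod_mset (image_mset (\<lambda>x. Poly_Mapping.single (f x) 1) M)
    = (Poly_Mapping.single (\<Sum>x\<in>#M. f x) 1 :: 'k::comm_monoid_add \<Rightarrow>\<^sub>0 int)"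
  by (induction M) (simp_all add: mult_single)

lemma lookup_sum_mset_single:
  "Poly_Mapping.lookup (\<Sum>x\<in>#P. Poly_Mapping.single x (1::int)) k = int (count P k)"
  by (induction P) (auto simp: lookup_add lookup_single when_def)

text \<open>Comparing generating functions in a monoid ring avoids constructing an isomorphism
  between two realisations: coefficients are integers that count cuts, so equal sums have equal
  multiplicities.\<close>

lemma cuts_determined:
  assumes "vertex_tree V" "shape V [] = T"
  shows "cuts V = cuts (vertices T)"
  using assms
proof (induction T arbitrary: V)
  case (B_plus M)
  \<comment> \<open>The generating function of \<open>cuts V\<close> is \<open>Crls_on V A B\<close> for the following universal \<open>A\<close> and
    \<open>B\<close>; it is computed from the branches of \<open>V\<close> since \<open>A\<close> is multiplicative.\<close>
  define A where "A T = (Poly_Mapping.single (branches T, {#}) 1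
      :: (rtree multiset \<times> rtree multiset) \<Rightarrow>\<^sub>0 int)" for T
  define a where "a T = (Poly_Mapping.single ({#T#}, {#}) 1
      :: (rtree multiset \<times> rtree multiset) \<Rightarrow>\<^sub>0 int)" for T
  define B where "B T = (Poly_Mapping.single ({#}, {#T#}) 1
      :: (rtree multiset \<times> rtree multiset) \<Rightarrow>\<^sub>0 int)" for T
  \<comment> \<open>A trunk is recorded by its multiset of branches, since joining trunks at a
    common root then becomes addition of exponents, which is the multiplicativity of
    \<open>A\<close>.\<close>
  define f where "f = (\<lambda>(T, N). (branches T, N :: rtree multiset))"
  have sumL: "(\<Sum>t\<in>#N. ({#t#}, {#})) = (N, {#} :: rtree multiset)" for N :: "rtree multiset"
    by (induction N) (simp_all add: zero_prod_def)
  have sumR: "(\<Sum>t\<in>#N. ({#}, {#t#})) = ({#} :: rtree multiset, N)" for N :: "rtree multiset"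
    by (induction N) (simp_all add: zero_prod_def)
  have A_mult: "A (B_plus N) = prod_mset (image_mset a N)" for N
    unfolding A_def a_def single_prod_mset sumL by simp
  have B_mult: "prod_mset (image_mset B N) = Poly_Mapping.single ({#}, N) 1" for N
    unfolding B_def single_prod_mset sumR by simp
  have gen: "Crls_on W A B = (\<Sum>x\<in>#image_mset f (cuts W). Poly_Mapping.single x 1)" for W
    unfolding Crls_on_eq_cuts B_mult multiset.map_comp
    by (rule arg_cong[of _ _ sum_mset], rule image_mset_cong)
      (auto simp: A_def f_def mult_single)
  have *: "Crls_on W A B = (\<Prod>t\<in>#M. B t + Crls_on (vertices t) a B)"
    if W: "vertex_tree W" "shape W [] = B_plus M" for W
  proof -
    have M: "M = image_mset (\<lambda>i. shape (branch i W) []) (mset_set (heads W))"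
      using shape_Nil[of W] W by (simp add: vertex_tree_def)
    have "Crls_on (branch i W) a B = Crls_on (vertices (shape (branch i W) [])) a B"
      if i: "i \<in> heads W" for i
    proof -
      have "shape (branch i W) [] \<in># M"
        using i finite_heads W unfolding M by (auto simp: vertex_tree_def)
      then show ?thesis
        unfolding Crls_on_eq_cuts
        using B_plus.IH vertex_tree_branch[OF W(1) i] by simp
    qed
    then show ?thesis
      unfolding Crls_on_factor[OF W(1) A_mult]
      by (subst M) (simp add: prod_unfold_prod_mset [symmetric] multiset.map_comp comp_def)
  qed
  have "image_mset f (cuts V) = image_mset f (cuts (vertices (B_plus M)))"
  proof (rule multiset_eqI)
    fix k
    have "Crls_on V A B = Crls_on (vertices (B_plus M)) A B"
      using *[OF B_plus.prems] *[OF vertex_tree_vertices shape_vertices] by simp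
    then show "count (image_mset f (cuts V)) k = count (image_mset f (cuts (vertices (B_plus M)))) k"
      unfolding gen by (metis lookup_sum_mset_single of_nat_eq_iff)
  qed
  moreover have "image_mset (\<lambda>(N, N'). (B_plus N, N')) (image_mset f P) = P" for P
  proof -
    have "B_plus (branches t) = t" for t by (cases t) simp
    then show ?thesis by (simp add: multiset.map_comp comp_def f_def case_prod_beta)
  qed
  ultimately show ?case by metis
qed

lemma Crls_on_eq_Crls_diamond:
  "vertex_tree V \<Longrightarrow> Crls_on V A B = Crls_diamond A B (shape V [])"
  unfolding Crls_diamond_eq_Crls_on Crls_on_eq_cuts using cuts_determined by metis

text \<open>Each branch of \<open>vertices (B_plus M)\<close> may now be exchanged for the chosen
  realisation of its shape, which gives a recursion on trees alone.\<close>

lemma Crls_diamond_B_plus: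
  assumes "\<And>N. A (B_plus N) = prod_mset (image_mset a N)"
  shows "Crls_diamond A B (B_plus M) = (\<Prod>t\<in>#M. B t + Crls_diamond a B t)"
proof -
  let ?V = "vertices (B_plus M)"
  have V: "vertex_tree ?V" by (rule vertex_tree_vertices)
  have M: "M = image_mset (\<lambda>i. shape (branch i ?V) []) (mset_set (heads ?V))"
    using shape_Nil[of ?V] V by (simp add: vertex_tree_def shape_vertices)
  have "Crls_diamond A B (B_plus M)
      = (\<Prod>i\<in>heads ?V. B (shape (branch i ?V) []) + Crls_diamond a B (shape (branch i ?V) []))"
    unfolding Crls_diamond_eq_Crls_on[of A] Crls_on_factor[OF V assms]
    by (intro prod.cong) (simp_all add: Crls_on_eq_Crls_diamond vertex_tree_branch[OF V])
  also have "\<dots> = (\<Prod>t\<in>#image_mset (\<lambda>i. shape (branch i ?V) []) (mset_set (heads ?V)).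
      B t + Crls_diamond a B t)"
    by (simp add: prod_unfold_prod_mset multiset.map_comp comp_def)
  finally show ?thesis unfolding M [symmetric] .
qed

text \<open>\<open>bullet\<close> is multiplicative in the branches with factor 0, its value at the
  one-vertex tree being the empty product.\<close>

lemma Crls_diamond_bullet_left: "Crls_diamond bullet B (B_plus M) = (\<Prod>t\<in>#M. B t)"
proof -
  have "bullet (B_plus N) = prod_mset (image_mset (\<lambda>_. 0) N)" for N
    by (cases N) (simp_all add: bullet_def)
  from Crls_diamond_B_plus[OF this] have
    "Crls_diamond bullet B (B_plus M) = (\<Prod>t\<in>#M. B t + Crls_diamond (\<lambda>_. 0) B t)" .
  then show ?thesis by (simp add: Crls_diamond_def)
qed

section \<open>Triangularity, rescaling and additivity\<close>

lemma num_vertices_shape: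
  assumes "vertex_tree S"
  shows "num_vertices (shape S []) = card S"
  using assms
proof (induction "card S" arbitrary: S rule: less_induct)
  case less
  then have fin: "finite S" and pc: "prefix_closed S" and Nil: "[] \<in> S"
    by (auto simp: vertex_tree_def)
  have S: "S = insert [] (\<Union>i\<in>heads S. (#) i ` branch i S)" (is "_ = insert [] ?U")
  proof (rule set_eqI)
    fix v
    show "v \<in> S \<longleftrightarrow> v \<in> insert [] ?U"
    proof (cases v)
      case (Cons i w)
      have "i \<in> heads S" if "v \<in> S"
        using prefix_closedD[OF pc, of "[i]" v] Cons that by (auto simp: heads_def)
      then show ?thesis using Cons by (auto simp: branch_def)
    qed (use Nil in simp)
  qed
  have "card S = Suc (card ?U)"
    using fin S by (metis (no_types, lifting) card_insert_disjoint finite_insert UN_E image_iff list.distinct(1))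
  also have "card ?U = (\<Sum>i\<in>heads S. card (branch i S))"
    by (subst card_UN_disjoint) (use finite_heads[OF fin] finite_branch[OF fin] in \<open>auto simp: card_image\<close>)
  finally have card: "card S = Suc (\<Sum>i\<in>heads S. card (branch i S))" .
  have "num_vertices (shape (branch i S) []) = card (branch i S)" if "i \<in> heads S" for i
  proof (rule less.hyps)
    show "card (branch i S) < card S"
      unfolding card less_Suc_eq_le using that finite_heads[OF fin] by (intro member_le_sum) auto
  qed (rule vertex_tree_branch[OF less.prems that])
  then show ?case
    unfolding shape_Nil[OF fin] card
    by (simp add: multiset.map_comp comp_def sum_unfold_sum_mset [symmetric])
qed

lemma vertex_tree_rooted_subtree: "vertex_tree V \<Longrightarrow> S \<in> rooted_subtrees V \<Longrightarrow> vertex_tree S"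
  by (auto simp: vertex_tree_def rooted_subtrees_def intro: finite_subset)

text \<open>The full vertex set has an empty frontier and contributes exactly \<open>A T\<close>;
  every other rooted subtree has fewer vertices. This serves both to solve the implicit equations
  and to compare two solutions by induction.\<close>

lemma Crls_diamond_lead_cong:
  assumes "\<And>T'. num_vertices T' < num_vertices T \<Longrightarrow> A T' = A' T'"
  shows "Crls_diamond A B T - A T = Crls_diamond A' B T - A' T"
proof -
  let ?V = "vertices T"
  let ?P = "\<lambda>S. \<Prod>v\<in>frontier ?V S. B (shape ?V v)"
  have V: "vertex_tree ?V" by (rule vertex_tree_vertices)
  then have "finite (rooted_subtrees ?V)" "?V \<in> rooted_subtrees ?V"
    by (auto simp: vertex_tree_def rooted_subtrees_def)
  moreover have "frontier ?V ?V = {}" by (auto simp: frontier_def)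
  ultimately have *: "Crls_diamond C B T - C T
      = (\<Sum>S\<in>rooted_subtrees ?V - {?V}. C (shape S []) * ?P S)" for C
    by (simp add: Crls_diamond_eq_Crls_on Crls_on_def sum.remove[of _ ?V] shape_vertices)
  have "num_vertices (shape S []) < num_vertices T" if "S \<in> rooted_subtrees ?V - {?V}" for S
  proof -
    have "card S < card ?V"
      using that V by (intro psubset_card_mono) (auto simp: vertex_tree_def rooted_subtrees_def)
    moreover have "vertex_tree S" using that V vertex_tree_rooted_subtree by blast
    ultimately show ?thesis
      using num_vertices_shape[of S] num_vertices_shape[OF V] by (simp add: shape_vertices)
  qed
  then show ?thesis unfolding * using assms by (intro sum.cong) auto
qed

lemma shape_eq_leafD: "finite V \<Longrightarrow> shape V v = B_plus {#} \<Longrightarrow> v @ [i] \<notin> V"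
  by (subst (asm) shape.simps) (auto simp: mset_set_empty_iff)

text \<open>Only subtrees whose complement consists of isolated vertices survive. For them the
  vertices of the subtree and the number of components add up to the size of \<open>T\<close>, so
  each term carries the same power of \<open>c\<close>.\<close>

lemma Crls_diamond_scale_bullet:
  "Crls_diamond (\<lambda>T. c ^ num_vertices T * A T) (\<lambda>T. c * bullet T) T
    = c ^ num_vertices T * Crls_diamond A bullet T"
proof -
  let ?V = "vertices T"
  have V: "vertex_tree ?V" by (rule vertex_tree_vertices)
  then have fin: "finite ?V" by (simp add: vertex_tree_def)
  have "c ^ num_vertices (shape S []) * A (shape S []) * (\<Prod>v\<in>frontier ?V S. c * bullet (shape ?V v))
      = c ^ num_vertices T * (A (shape S []) * (\<Prod>v\<in>frontier ?V S. bullet (shape ?V v)))"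
    if S: "S \<in> rooted_subtrees ?V" for S
  proof (cases "\<forall>v\<in>frontier ?V S. shape ?V v = B_plus {#}")
    case True
    have sub: "S \<subseteq> ?V" "[] \<in> S" using S by (auto simp: rooted_subtrees_def)
    \<comment> \<open>If the parent were outside \<open>S\<close>, it would by induction be a
      frontier vertex with a child, contrary to its shape being a single vertex.\<close>
    have "v \<in> frontier ?V S" if "v \<in> ?V - S" for v
      using that
    proof (induction v rule: rev_induct)
      case (snoc i v)
      have "v \<in> S"
      proof (rule ccontr)
        assume "v \<notin> S"
        then have "v \<in> frontier ?V S"
          using snoc V by (auto simp: vertex_tree_def prefix_closed_def)
        then show False using True shape_eq_leafD[OF fin, of v i] snoc.prems by auto
      qed
      then show ?case using snoc.prems by (auto simp: frontier_def)
    qed (use sub in simp)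
    then have "frontier ?V S = ?V - S" by (auto simp: frontier_def)
    then have "num_vertices T = num_vertices (shape S []) + card (frontier ?V S)"
      using num_vertices_shape[OF V] num_vertices_shape[OF vertex_tree_rooted_subtree[OF V S]]
        card_Diff_subset[OF finite_subset[OF sub(1) fin] sub(1)] card_mono[OF fin sub(1)]
      by (simp add: shape_vertices)
    then show ?thesis using True by (simp add: prod.distrib power_add bullet_def)
  next
    case False
    then have "\<exists>v\<in>frontier ?V S. bullet (shape ?V v) = (0 :: 'a)"
      by (auto simp: bullet_def)
    moreover have "finite (frontier ?V S)" using fin by (simp add: frontier_def)
    ultimately have "(\<Prod>v\<in>frontier ?V S. bullet (shape ?V v)) = (0 :: 'a)"
      by (intro prod_zero) auto
    then show ?thesis by (simp add: prod.distrib)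
  qed
  then show ?thesis
    unfolding Crls_diamond_eq_Crls_on Crls_on_def sum_distrib_left
    by (intro sum.cong) auto
qed

lemma additive_mult_of_int:
  fixes h :: "'a::comm_ring_1 \<Rightarrow> 'b::comm_ring_1"
  assumes "additive h"
  shows "h (x * of_int k) = h x * of_int k"
proof -
  interpret additive h by (rule assms)
  have nat: "h (x * of_nat n) = h x * of_nat n" for n
    by (induction n) (simp_all add: add zero algebra_simps)
  show ?thesis
    by (cases k rule: int_cases2) (simp_all add: nat minus)
qed

text \<open>With integer values in the second argument, each coefficient is an integer combination
  of values of \<open>A\<close>. Hence \<open>h\<close> need not be multiplicative, which admits
  derivatives and differences.\<close>

lemma Crls_diamond_additive:
  fixes h :: "'a::comm_ring_1 \<Rightarrow> 'b::comm_ring_1" and b :: "int tree_series"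
  assumes "additive h"
  shows "h (Crls_diamond A (\<lambda>T. of_int (b T)) T)
    = Crls_diamond (\<lambda>T. h (A T)) (\<lambda>T. of_int (b T)) T"
  unfolding Crls_diamond_def additive.sum[OF assms] of_int_prod [symmetric]
    additive_mult_of_int[OF assms] ..

section \<open>The coefficient field\<close>

lemma to_fract_power: "to_fract (p ^ n) = to_fract p ^ n"
  by (induction n) simp_all

lemma qvar_nonzero [simp]: "qvar \<noteq> 0"
  by (simp add: qvar_def)

lemma qvar_power_neq_1 [simp]:
  assumes "n > 0"
  shows "qvar ^ n \<noteq> 1"
proof
  assume "qvar ^ n = 1"
  then have "to_fract ([:0, 1:] ^ n :: rat poly) = to_fract 1"
    by (simp add: qvar_def to_fract_power)
  then have "[:0, 1:] ^ n = (1 :: rat poly)"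
    by (simp only: to_fract_eq_iff)
  then have "poly ([:0, 1:] ^ n :: rat poly) 0 = poly 1 0" by simp
  then show False using assms by (simp add: poly_power power_0_left)
qed

lemma qvar_neq_1 [simp]: "qvar \<noteq> 1"
  using qvar_power_neq_1[of 1] by simp

lemma eval_rat_poly_0 [simp]: "eval_rat_poly 0 a = 0"
  by (simp add: eval_rat_poly_def)

lemma eval_rat_poly_pCons:
  "eval_rat_poly (pCons c p) a = to_fract [:c:] + a * eval_rat_poly p a"
  by (cases "p = 0 \<and> c = 0") (auto simp: eval_rat_poly_def map_poly_pCons)

lemma eval_rat_poly_1 [simp]: "eval_rat_poly 1 a = 1"
  by (simp add: one_pCons eval_rat_poly_pCons flip: to_fract_1)

lemma eval_rat_poly_add: "eval_rat_poly (p + r) a = eval_rat_poly p a + eval_rat_poly r a"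
proof (induction p r rule: poly_induct2)
  case (pCons c p d r)
  have "to_fract [:c + d:] = to_fract [:c:] + to_fract [:d:]"
    by (simp flip: to_fract_add)
  then show ?case using pCons by (simp add: eval_rat_poly_pCons algebra_simps)
qed simp

lemma eval_rat_poly_smult: "eval_rat_poly (smult c p) a = to_fract [:c:] * eval_rat_poly p a"
proof (induction p)
  case (pCons d p)
  have "to_fract [:c * d:] = to_fract [:c:] * to_fract [:d:]"
    by (simp flip: to_fract_mult)
  then show ?case using pCons by (simp add: eval_rat_poly_pCons algebra_simps)
qed simp

lemma eval_rat_poly_mult: "eval_rat_poly (p * r) a = eval_rat_poly p a * eval_rat_poly r a"
  by (induction p)
    (simp_all add: eval_rat_poly_add eval_rat_poly_smult eval_rat_poly_pCons algebra_simps)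

text \<open>Clearing the powers of 1/q leaves the reversed polynomial. It is needed to know that
  denominators survive the substitution.\<close>

lemma eval_rat_poly_inverse_qvar:
  assumes "p \<noteq> 0"
  shows "\<exists>r m. r \<noteq> 0 \<and> degree r \<le> m \<and> eval_rat_poly p (1 / qvar) * qvar ^ m = to_fract r"
  using assms
proof (induction p)
  case (pCons c p)
  show ?case
  proof (cases "p = 0")
    case True
    with pCons show ?thesis
      by (intro exI[of _ "[:c:]"] exI[of _ 0]) (simp add: eval_rat_poly_pCons)
  next
    case False
    with pCons.IH obtain r m where r: "r \<noteq> 0" "degree r \<le> m"
      "eval_rat_poly p (1 / qvar) * qvar ^ m = to_fract r" by blast
    \<comment> \<open>The bound \<open>degree r \<le> m\<close> keeps the new term, of exponent
      \<open>Suc m\<close>, away from the leading coefficient of \<open>r\<close>.\<close>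
    define s where "s = monom c (Suc m) + r"
    have "coeff s (degree r) = lead_coeff r"
      using r(2) by (simp add: s_def)
    then have "s \<noteq> 0" using r(1) by auto
    moreover have "degree s \<le> Suc m"
      unfolding s_def using r(2) by (intro degree_add_le) (auto intro: degree_monom_le)
    moreover have "eval_rat_poly (pCons c p) (1 / qvar) * qvar ^ Suc m = to_fract s"
    proof -
      have "monom c (Suc m) = [:c:] * [:0, 1:] ^ Suc m"
        by (simp add: monom_altdef)
      then have "to_fract s = to_fract [:c:] * qvar ^ Suc m + to_fract r"
        by (simp only: s_def to_fract_add to_fract_mult to_fract_power qvar_def)
      then show ?thesis using r(3) by (simp add: eval_rat_poly_pCons field_simps)
    qed
    ultimately show ?thesis by blast
  qed
qed simp

lemma eval_rat_poly_inverse_qvar_nonzero: "p \<noteq> 0 \<Longrightarrow> eval_rat_poly p (1 / qvar) \<noteq> 0"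
  using eval_rat_poly_inverse_qvar[of p] by auto

lemma quot_of_fract_divide:
  assumes "quot_of_fract f = (a, b)"
  shows "b \<noteq> 0" "f = to_fract a / to_fract b"
  using assms snd_quot_of_fract_nonzero[of f] Fract_quot_of_fract[of f]
  by (simp_all add: Fract_conv_to_fract)

text \<open>The definition uses the normalised quotient; cross-multiplication carries it over to any
  quotient, which makes \<open>invert_q\<close> a ring homomorphism.\<close>

lemma invert_q_divide:
  assumes "b \<noteq> 0"
  shows "invert_q (to_fract a / to_fract b)
    = eval_rat_poly a (1 / qvar) / eval_rat_poly b (1 / qvar)"
proof -
  let ?f = "to_fract a / to_fract b :: Qq"
  obtain c d where cd: "quot_of_fract ?f = (c, d)" by (cases "quot_of_fract ?f")
  note d = quot_of_fract_divide[OF cd]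
  have "to_fract (a * d) = to_fract (c * b)" using assms d by (simp add: frac_eq_eq)
  then have "a * d = c * b" by (simp only: to_fract_eq_iff)
  then have "eval_rat_poly c (1 / qvar) * eval_rat_poly b (1 / qvar)
      = eval_rat_poly a (1 / qvar) * eval_rat_poly d (1 / qvar)"
    by (simp flip: eval_rat_poly_mult)
  then have "eval_rat_poly c (1 / qvar) / eval_rat_poly d (1 / qvar)
      = eval_rat_poly a (1 / qvar) / eval_rat_poly b (1 / qvar)"
    by (simp add: frac_eq_eq eval_rat_poly_inverse_qvar_nonzero assms d(1))
  then show ?thesis by (simp only: invert_q_def cd prod.case)
qed

lemma Qq_cases: obtains a b where "b \<noteq> 0" "(f :: Qq) = to_fract a / to_fract b"
  using quot_of_fract_divide[of f] by (cases "quot_of_fract f") blast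

lemma invert_q_add: "invert_q (f + g) = invert_q f + invert_q g"
proof -
  obtain a b where f: "b \<noteq> 0" "f = to_fract a / to_fract b" by (rule Qq_cases)
  obtain c d where g: "d \<noteq> 0" "g = to_fract c / to_fract d" by (rule Qq_cases)
  have "f + g = to_fract (a * d + c * b) / to_fract (b * d)"
    using f g by (simp add: add_frac_eq)
  moreover have "b * d \<noteq> 0" using f g by simp
  ultimately have "invert_q (f + g)
      = eval_rat_poly (a * d + c * b) (1 / qvar) / eval_rat_poly (b * d) (1 / qvar)"
    by (metis invert_q_divide)
  also have "\<dots> = eval_rat_poly a (1 / qvar) / eval_rat_poly b (1 / qvar)
      + eval_rat_poly c (1 / qvar) / eval_rat_poly d (1 / qvar)"
    by (simp add: eval_rat_poly_add eval_rat_poly_mult add_frac_eq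
        eval_rat_poly_inverse_qvar_nonzero f(1) g(1))
  also have "\<dots> = invert_q f + invert_q g"
    by (simp only: f(2) g(2) invert_q_divide[OF f(1)] invert_q_divide[OF g(1)])
  finally show ?thesis .
qed

lemma invert_q_mult: "invert_q (f * g) = invert_q f * invert_q g"
proof -
  obtain a b where f: "b \<noteq> 0" "f = to_fract a / to_fract b" by (rule Qq_cases)
  obtain c d where g: "d \<noteq> 0" "g = to_fract c / to_fract d" by (rule Qq_cases)
  have "f * g = to_fract (a * c) / to_fract (b * d)"
    using f g by simp
  moreover have "b * d \<noteq> 0" using f g by simp
  ultimately have "invert_q (f * g)
      = eval_rat_poly (a * c) (1 / qvar) / eval_rat_poly (b * d) (1 / qvar)"
    by (metis invert_q_divide)
  also have "\<dots> = invert_q f * invert_q g"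
    by (simp only: f(2) g(2) invert_q_divide[OF f(1)] invert_q_divide[OF g(1)]
        eval_rat_poly_mult times_divide_times_eq)
  finally show ?thesis .
qed

lemma additive_invert_q: "additive invert_q"
  by unfold_locales (rule invert_q_add)

lemma invert_q_0 [simp]: "invert_q 0 = 0"
  and invert_q_1 [simp]: "invert_q 1 = 1"
  and invert_q_qvar [simp]: "invert_q qvar = 1 / qvar"
  using invert_q_divide[of 1 0] invert_q_divide[of 1 1] invert_q_divide[of 1 "[:0, 1:]"]
  by (simp_all add: qvar_def eval_rat_poly_pCons pCons_one)

lemma invert_q_power: "invert_q (f ^ n) = invert_q f ^ n"
  by (induction n) (simp_all add: invert_q_mult)

section \<open>Bernoulli--Carlitz numbers\<close>

text \<open>This justifies the \<open>THE\<close> definitions: each implicit equation is solved for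
  its unknown of largest size.\<close>

lemma ex1_measure_recursion:
  fixes m :: "'a \<Rightarrow> nat"
  assumes "\<And>f g x. (\<And>y. m y < m x \<Longrightarrow> f y = g y) \<Longrightarrow> \<Phi> f x = \<Phi> g x"
  shows "\<exists>!f. \<forall>x. f x = \<Phi> f x"
proof (rule ex_ex1I)
  have "adm_wf (measure m) \<Phi>"
    unfolding adm_wf_def by (intro allI impI) (rule assms, simp)
  from wfrec_fixpoint[OF wf_measure this] have "\<forall>x. wfrec (measure m) \<Phi> x = \<Phi> (wfrec (measure m) \<Phi>) x"
    by (intro allI) (rule fun_cong)
  then show "\<exists>f. \<forall>x. f x = \<Phi> f x"
    by (rule exI[of "\<lambda>f. \<forall>x. f x = \<Phi> f x"])
next
  fix f g assume *: "\<forall>x. f x = \<Phi> f x" "\<forall>x. g x = \<Phi> g x"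
  have "f x = g x" for x
  proof (induction "m x" arbitrary: x rule: less_induct)
    case less
    have "\<Phi> f x = \<Phi> g x" by (rule assms) (rule less)
    with * show ?case by simp
  qed
  then show "f = g" by (rule ext)
qed

lemma Bernoulli_Carlitz_props:
  "Bernoulli_Carlitz 0 = 1"
  "n \<ge> 1 \<Longrightarrow> qvar * (\<Sum>k\<le>n. of_nat (n choose k) * qvar ^ k * Bernoulli_Carlitz k)
     - Bernoulli_Carlitz n = (if n = 1 then 1 else 0)"
proof -
  \<comment> \<open>The summand \<open>k = n\<close> gives \<open>b n\<close> the total coefficient
    \<open>qvar ^ Suc n - 1\<close>, hence the divisor.\<close>
  define \<Phi> where "\<Phi> b n = (if n = 0 then 1 else
    ((if n = 1 then 1 else 0) - qvar * (\<Sum>k<n. of_nat (n choose k) * qvar ^ k * b k))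
      / (qvar ^ Suc n - 1))" for b :: "nat \<Rightarrow> Qq" and n
  have ex1: "\<exists>!b. \<forall>n. b n = \<Phi> b n"
    by (rule ex1_measure_recursion[of "\<lambda>n. n"]) (simp add: \<Phi>_def)
  have "(\<forall>n. b n = \<Phi> b n) \<longleftrightarrow> b 0 = 1 \<and>
    (\<forall>n\<ge>1. qvar * (\<Sum>k\<le>n. of_nat (n choose k) * qvar ^ k * b k) - b n
       = (if n = 1 then 1 else 0))" for b
  proof -
    have "b n = \<Phi> b n \<longleftrightarrow> qvar * (\<Sum>k\<le>n. of_nat (n choose k) * qvar ^ k * b k) - b n
       = (if n = 1 then 1 else 0)" if "n \<ge> 1" for n
    proof -
      define s where "s = (\<Sum>k<n. of_nat (n choose k) * qvar ^ k * b k)"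
      define d :: Qq where "d = (if n = 1 then 1 else 0)"
      have nz: "qvar ^ Suc n - 1 \<noteq> 0" using qvar_power_neq_1[of "Suc n"] by simp
      have "\<Phi> b n = (d - qvar * s) / (qvar ^ Suc n - 1)"
        using that by (simp add: \<Phi>_def s_def d_def)
      then have "b n = \<Phi> b n \<longleftrightarrow> b n * (qvar ^ Suc n - 1) = d - qvar * s"
        using nonzero_eq_divide_eq[OF nz] by metis
      also have "\<dots> \<longleftrightarrow> qvar * (s + qvar ^ n * b n) - b n = d"
        by (auto simp: algebra_simps)
      also have "s + qvar ^ n * b n = (\<Sum>k\<le>n. of_nat (n choose k) * qvar ^ k * b k)"
        unfolding lessThan_Suc_atMost [symmetric] sum.lessThan_Suc s_def by simp
      finally show ?thesis unfolding d_def .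
    qed
    moreover have "\<Phi> b 0 = 1" by (simp add: \<Phi>_def)
    moreover have "(\<forall>n. b n = \<Phi> b n) \<longleftrightarrow> b 0 = \<Phi> b 0 \<and> (\<forall>n\<ge>1. b n = \<Phi> b n)"
      by (metis less_one not_le)
    ultimately show ?thesis by simp
  qed
  with ex1 have "\<exists>!b. b 0 = 1 \<and>
    (\<forall>n\<ge>1. qvar * (\<Sum>k\<le>n. of_nat (n choose k) * qvar ^ k * b k) - b n
       = (if n = 1 then 1 else 0))" by (simp only:)
  from theI'[OF this, folded Bernoulli_Carlitz_def]
  show "Bernoulli_Carlitz 0 = 1"
    "n \<ge> 1 \<Longrightarrow> qvar * (\<Sum>k\<le>n. of_nat (n choose k) * qvar ^ k * Bernoulli_Carlitz k)
       - Bernoulli_Carlitz n = (if n = 1 then 1 else 0)" by auto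
qed

section \<open>The linear form Psi and the shift of q-integers\<close>

lemma Psi_eq_sum:
  assumes "degree p \<le> n"
  shows "Psi p = (\<Sum>k\<le>n. coeff p k * Bernoulli_Carlitz k)"
  unfolding Psi_def
  by (rule sum.mono_neutral_left) (use assms in \<open>auto simp: coeff_eq_0\<close>)

lemma Psi_add: "Psi (p + r) = Psi p + Psi r"
proof -
  let ?n = "max (degree p) (degree r)"
  have "degree (p + r) \<le> ?n" by (simp add: degree_add_le)
  then show ?thesis
    by (simp add: Psi_eq_sum[of _ ?n] sum.distrib algebra_simps)
qed

lemma Psi_smult: "Psi (smult c p) = c * Psi p"
  using Psi_eq_sum[of "smult c p" "degree p"]
  by (simp add: degree_smult_le Psi_def sum_distrib_left algebra_simps)

lemma Psi_monom: "Psi (monom c n) = c * Bernoulli_Carlitz n"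
  by (simp add: Psi_eq_sum[of _ n] degree_monom_le if_distrib[of "\<lambda>x. x * _"] cong: if_cong)

lemma additive_Psi: "additive Psi"
  by unfold_locales (rule Psi_add)

lemmas Psi_sum = additive.sum[OF additive_Psi]
  and Psi_diff = additive.diff[OF additive_Psi]
  and Psi_minus = additive.minus[OF additive_Psi]

text \<open>This substitution sends the \<open>q\<close>-integer \<open>[n]\<close> to \<open>[n + 1]\<close>.\<close>

definition shift_q :: "Qq poly \<Rightarrow> Qq poly" where
  "shift_q p = pcompose p [:1, qvar:]"

lemma shift_q_add: "shift_q (p + r) = shift_q p + shift_q r"
  and shift_q_diff: "shift_q (p - r) = shift_q p - shift_q r"
  and shift_q_mult: "shift_q (p * r) = shift_q p * shift_q r"
  and shift_q_smult: "shift_q (smult c p) = smult c (shift_q p)"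
  and shift_q_1 [simp]: "shift_q 1 = 1"
  and shift_q_0 [simp]: "shift_q 0 = 0"
  by (simp_all add: shift_q_def pcompose_add pcompose_diff pcompose_mult pcompose_smult pcompose_1)

lemma additive_shift_q: "additive shift_q"
  by unfold_locales (rule shift_q_add)

lemma shift_q_power: "shift_q (p ^ n) = shift_q p ^ n"
  by (induction n) (simp_all add: shift_q_mult)

lemma shift_q_prod_mset: "shift_q (prod_mset M) = prod_mset (image_mset shift_q M)"
  by (induction M) (simp_all add: shift_q_mult)

lemma shift_q_linear: "shift_q [:1, qvar - 1:] = smult qvar [:1, qvar - 1:]"
  by (simp add: shift_q_def pcompose_pCons algebra_simps)

lemma shift_q_bullet [simp]: "shift_q (bullet T) = bullet T"
  by (simp add: bullet_def)

text \<open>Both sides are linear in \<open>p\<close>, and on monomials this is the recursion of the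
  Bernoulli-Carlitz numbers; the constant monomial accounts for the term with
  \<open>qvar - 1\<close>.\<close>

lemma Psi_shift_q: "qvar * Psi (shift_q p) - Psi p = coeff p 1 + (qvar - 1) * coeff p 0"
proof -
  define h where "h p = qvar * Psi (shift_q p) - Psi p - coeff p 1 - (qvar - 1) * coeff p 0" for p
  have h_add: "additive h"
    by unfold_locales (simp add: h_def shift_q_add Psi_add algebra_simps)
  have h_smult: "h (smult c p) = c * h p" for c p
    by (simp add: h_def shift_q_smult Psi_smult algebra_simps)
  have h_monom: "h (monom 1 n) = 0" for n
  proof -
    have "shift_q (monom 1 n) = [:1, qvar:] ^ n"
      by (simp add: monom_altdef shift_q_power) (simp add: shift_q_def pcompose_pCons)
    also have "\<dots> = (monom qvar 1 + 1) ^ n"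
      by (simp add: monom_altdef one_pCons)
    also have "\<dots> = (\<Sum>k\<le>n. monom (of_nat (n choose k) * qvar ^ k) k)"
      by (simp add: binomial_ring monom_power of_nat_monom mult_monom)
    finally have "Psi (shift_q (monom 1 n))
        = (\<Sum>k\<le>n. of_nat (n choose k) * qvar ^ k * Bernoulli_Carlitz k)"
      by (simp add: Psi_sum Psi_monom)
    then show ?thesis
      using Bernoulli_Carlitz_props(1) Bernoulli_Carlitz_props(2)[of n]
      by (cases "n = 0") (auto simp: h_def Psi_monom)
  qed
  have "h p = h (\<Sum>i\<le>degree p. smult (coeff p i) (monom 1 i))"
    by (simp add: smult_monom poly_as_sum_of_monoms)
  also have "\<dots> = 0"
    by (simp add: additive.sum[OF h_add] h_smult h_monom)
  finally show ?thesis by (simp add: h_def algebra_simps)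
qed

text \<open>\<open>Psi_shift_q\<close> evaluates \<open>Psi\<close> only on images of this operator,
  so surjectivity makes it applicable to every polynomial.\<close>

lemma ex_shift_q_preimage: "\<exists>p. smult qvar (shift_q p) - p = g"
proof -
  \<comment> \<open>\<open>y = 1 + (q - 1) x\<close> is an eigenvector of the substitution.\<close>
  let ?y = "[:1, qvar - 1:]"
  \<comment> \<open>The substitution inverse to \<open>?y\<close>, so that \<open>r\<close> holds
    the coefficients of \<open>g\<close> in powers of \<open>?y\<close>.\<close>
  let ?z = "[:- 1 / (qvar - 1), 1 / (qvar - 1):]"
  define r where "r = pcompose g ?z"
  \<comment> \<open>On \<open>?y ^ i\<close> the operator acts as the scalar
    \<open>qvar ^ Suc i - 1\<close>, which is nonzero.\<close>
  define p where "p = (\<Sum>i\<le>degree r. smult (coeff r i / (qvar ^ Suc i - 1)) (?y ^ i))"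
  have add: "additive (\<lambda>p. smult qvar (shift_q p) - p)"
    by unfold_locales (simp add: shift_q_add smult_add_right)
  have "smult qvar (shift_q p) - p = (\<Sum>i\<le>degree r. smult (coeff r i) (?y ^ i))"
    unfolding p_def additive.sum[OF add]
  proof (rule sum.cong[OF refl])
    fix i
    define Y where "Y = ?y ^ i"
    have Y: "shift_q Y = smult (qvar ^ i) Y"
      unfolding Y_def shift_q_power shift_q_linear smult_power ..
    have "smult qvar (shift_q (smult c Y)) - smult c Y = smult (c * (qvar ^ Suc i - 1)) Y" for c
      unfolding shift_q_smult Y by (simp add: poly_eq_iff algebra_simps)
    from this[of "coeff r i / (qvar ^ Suc i - 1)", unfolded Y_def]
    show "smult qvar (shift_q (smult (coeff r i / (qvar ^ Suc i - 1)) (?y ^ i)))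
        - smult (coeff r i / (qvar ^ Suc i - 1)) (?y ^ i) = smult (coeff r i) (?y ^ i)"
      using qvar_power_neq_1[of "Suc i"] by (simp del: power_Suc)
  qed
  also have "\<dots> = pcompose r ?y"
  proof -
    have pow: "pcompose (monom 1 i) ?y = ?y ^ i" for i
      by (induction i) (simp_all add: pcompose_1 monom_Suc pcompose_pCons)
    have "pcompose r ?y = pcompose (\<Sum>i\<le>degree r. smult (coeff r i) (monom 1 i)) ?y"
      by (simp add: smult_monom poly_as_sum_of_monoms)
    then show ?thesis by (simp add: pcompose_sum pcompose_smult pow)
  qed
  also have "\<dots> = g"
    unfolding r_def pcompose_assoc [symmetric]
    by (simp add: pcompose_pCons field_simps)
  finally show ?thesis by blast
qed

text \<open>The shift multiplies the leading coefficient by \<open>qvar ^ degree p\<close>, which is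
  1 only in degree 0.\<close>

lemma shift_q_fixed:
  assumes "shift_q p = p"
  shows "degree p = 0"
proof (rule ccontr)
  assume "degree p \<noteq> 0"
  moreover have "lead_coeff (shift_q p) = lead_coeff p * qvar ^ degree p"
    by (simp add: shift_q_def lead_coeff_comp)
  ultimately show False using assms by auto
qed

text \<open>The value at \<open>0\<close> of the derivative of \<open>F ((x - 1) / q)\<close>.\<close>

definition deriv_at_minus_1 :: "Qq poly \<Rightarrow> Qq" where
  "deriv_at_minus_1 F = poly (pderiv F) (- 1 / qvar) / qvar"

lemma additive_deriv_at_minus_1: "additive deriv_at_minus_1"
  by unfold_locales (simp add: deriv_at_minus_1_def pderiv_add add_divide_distrib)

text \<open>\<open>F'\<close> is \<open>F\<close> composed with (x - 1)/q, which sends 0 to -1/q.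
  Its two lowest coefficients are what \<open>Psi_shift_q\<close> reads off.\<close>

lemma unshift_q:
  obtains F' where "shift_q F' = F" "coeff F' 0 = poly F (- 1 / qvar)"
    "coeff F' 1 = deriv_at_minus_1 F"
proof -
  let ?z = "[:- 1 / qvar, 1 / qvar:]"
  define F' where "F' = pcompose F ?z"
  have "shift_q F' = F"
    unfolding F'_def shift_q_def pcompose_assoc [symmetric]
    by (simp add: pcompose_pCons)
  moreover have "coeff F' 0 = poly F (- 1 / qvar)"
    by (simp add: F'_def flip: poly_0_coeff_0) (simp add: poly_pcompose)
  moreover have "coeff F' 1 = poly (pderiv F') 0"
    by (simp add: poly_0_coeff_0 coeff_pderiv)
  then have "coeff F' 1 = deriv_at_minus_1 F"
    by (simp add: F'_def pderiv_pcompose poly_pcompose deriv_at_minus_1_def pderiv_pCons)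
  ultimately show ?thesis using that by blast
qed

lemma inj_shift_q: "shift_q p = shift_q r \<Longrightarrow> p = r"
  using pcompose_eq_0[of "p - r" "[:1, qvar:]"] by (simp add: shift_q_def pcompose_diff)

lemma unshift_q_difference:
  assumes "shift_q F - F = smult qvar [:1, qvar - 1:] * shift_q g" "shift_q F' = F"
  shows "F - F' = [:1, qvar - 1:] * g"
proof (rule inj_shift_q)
  show "shift_q (F - F') = shift_q ([:1, qvar - 1:] * g)"
    using assms unfolding shift_q_diff shift_q_mult shift_q_linear by simp
qed

text \<open>With \<open>g\<close> written as \<open>smult qvar (shift_q p) - p\<close>, the
  polynomials \<open>F'\<close> and \<open>?y * p\<close> have the same difference and so agree up
  to a constant. The linear coefficient of \<open>?y * p\<close> is exactly the right-hand side of
  \<open>Psi_shift_q\<close> for \<open>p\<close>.\<close>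

lemma Psi_eq_deriv_at_minus_1:
  assumes "shift_q F - F = smult qvar [:1, qvar - 1:] * shift_q g"
  shows "Psi g = deriv_at_minus_1 F"
proof -
  let ?y = "[:1, qvar - 1:]"
  obtain F' where F': "shift_q F' = F" "coeff F' 1 = deriv_at_minus_1 F"
    by (rule unshift_q[of F])
  obtain p where p: "smult qvar (shift_q p) - p = g" using ex_shift_q_preimage by blast
  have "F - F' = ?y * g" by (rule unshift_q_difference[OF assms F'(1)])
  then have "F - F' = shift_q (?y * p) - ?y * p"
    unfolding shift_q_mult shift_q_linear p [symmetric]
    by (simp only: right_diff_distrib mult_smult_left mult_smult_right)
  then have "shift_q (F' - ?y * p) = F' - ?y * p"
    unfolding shift_q_diff F'(1) by (simp only: algebra_simps)
  then have "degree (F' - ?y * p) = 0" by (rule shift_q_fixed)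
  then have "coeff (F' - ?y * p) 1 = 0" by (intro coeff_eq_0) simp
  then have "coeff F' 1 = coeff p 1 + (qvar - 1) * coeff p 0"
    by (simp add: algebra_simps)
  then show ?thesis
    using Psi_shift_q[of p] p F'(2) by (simp add: Psi_diff Psi_smult flip: p)
qed

text \<open>\<open>Psi F'\<close> is computed twice: from the difference \<open>F - F'\<close>,
  whose factor 1 + (q - 1) x produces the term with \<open>xvar * g\<close>, and from
  \<open>Psi_shift_q\<close>, where \<open>zero\<close> removes the constant coefficient. The two
  occurrences of \<open>Psi g\<close> cancel.\<close>

lemma Psi_by_parts:
  assumes F: "shift_q F - F = smult qvar [:1, qvar - 1:] * shift_q g"
    and zero: "poly F (- 1 / qvar) = 0"
  shows "Psi F = Psi (- xvar * g)"
proof -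
  obtain F' where F': "shift_q F' = F" "coeff F' 0 = poly F (- 1 / qvar)"
    "coeff F' 1 = deriv_at_minus_1 F"
    by (rule unshift_q[of F])
  have "F' = F - (g + smult (qvar - 1) (xvar * g))"
    using unshift_q_difference[OF F F'(1)] by (simp add: xvar_def algebra_simps)
  then have "Psi F' = Psi F - Psi g - (qvar - 1) * Psi (xvar * g)"
    by (simp add: Psi_diff Psi_add Psi_smult)
  moreover have "qvar * Psi F - Psi F' = Psi g"
    using Psi_shift_q[of F'] F' zero Psi_eq_deriv_at_minus_1[OF F] by simp
  ultimately have "(qvar - 1) * Psi F = (qvar - 1) * - Psi (xvar * g)"
    by (simp add: algebra_simps)
  then have "Psi F = - Psi (xvar * g)" by (subst (asm) mult_cancel_left) simp
  then show ?thesis by (simp add: Psi_minus)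
qed

section \<open>The tree series\<close>

lemma num_vertices_pos [simp]: "num_vertices T > 0"
  by (cases T) simp

lemma power_num_vertices: "c ^ num_vertices T = c * c ^ (num_vertices T - 1)"
  by (cases T) simp

lemma num_vertices_branch_less: "t \<in># M \<Longrightarrow> num_vertices t < num_vertices (B_plus M)"
  by (auto dest: multi_member_split)

lemma prod_mset_power_num_vertices:
  "(\<Prod>t\<in>#M. c ^ num_vertices t * f t)
    = (c ^ (num_vertices (B_plus M) - 1) * (\<Prod>t\<in>#M. f t) :: 'a::comm_ring_1)"
  by (induction M) (simp_all add: power_add algebra_simps)

lemma const_poly_power_mult: "[:c:] ^ n * p = smult (c ^ n) (p :: 'a::comm_ring_1 poly)"
  by (induction n arbitrary: p) (simp_all add: mult.assoc)

lemma prod_mset_smult_num_vertices: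
  "(\<Prod>t\<in>#M. smult (c ^ num_vertices t) (f t))
    = smult (c ^ (num_vertices (B_plus M) - 1)) (\<Prod>t\<in>#M. f t :: 'a::comm_ring_1 poly)"
  using prod_mset_power_num_vertices[of "[:c:]" f M] by (simp only: const_poly_power_mult)

lemma const_mult_Sigma_series: "c * Sigma_series c A T = c ^ num_vertices T * A T"
  using num_vertices_pos[of T]
  by (simp add: Sigma_series_def flip: mult.assoc power_Suc)

lemma bullet_eq_of_int: "bullet = (\<lambda>T. of_int (bullet T))"
  by (auto simp: bullet_def)

lemma neg_bullet_eq_of_int: "(\<lambda>T. - bullet T) = (\<lambda>T. of_int (- bullet T))"
  by (auto simp: bullet_def)

lemma Crls_diamond_neg_bullet_additive:
  assumes "additive h"
  shows "h (Crls_diamond A (\<lambda>T. - bullet T) T) = Crls_diamond (\<lambda>T. h (A T)) (\<lambda>T. - bullet T) T"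
  unfolding neg_bullet_eq_of_int by (rule Crls_diamond_additive[OF assms])

lemma Crls_diamond_bullet_additive:
  assumes "additive h"
  shows "h (Crls_diamond A bullet T) = Crls_diamond (\<lambda>T. h (A T)) bullet T"
  by (subst (1 2) bullet_eq_of_int) (rule Crls_diamond_additive[OF assms])

lemma graft_on_bullet_B_plus [simp]: "graft_on_bullet A (B_plus {#t#}) = A t"
  by (simp add: graft_on_bullet_def)

lemma graft_on_bullet_cong:
  assumes "\<And>T'. num_vertices T' < num_vertices T \<Longrightarrow> A T' = A' T'"
  shows "graft_on_bullet A T = graft_on_bullet A' T"
proof (cases "\<exists>t. T = B_plus {#t#}")
  case True
  then obtain t where "T = B_plus {#t#}" by blast
  then show ?thesis using assms[of t] by simp
qed (simp add: graft_on_bullet_def)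

text \<open>Here \<open>a\<close> stands for the coefficient at a tree and \<open>C\<close> for that
  of \<open>Crls_diamond\<close>; the grouping \<open>C - a\<close> is the part that involves
  smaller trees only.\<close>

lemma smult_minus_eq_iff:
  fixes a :: "'a::field poly"
  assumes "c \<noteq> 1"
  shows "smult c a - C = R \<longleftrightarrow> a = smult (inverse (c - 1)) (R + (C - a))"
proof -
  have "smult c a - C = R \<longleftrightarrow> smult (c - 1) a = R + (C - a)"
    by (auto simp: smult_diff_left algebra_simps)
  also have "\<dots> \<longleftrightarrow> a = smult (inverse (c - 1)) (R + (C - a))"
    (is "smult _ a = ?X \<longleftrightarrow> _")
  proof
    assume "smult (c - 1) a = ?X"
    then have "smult (inverse (c - 1)) ?X = smult (inverse (c - 1)) (smult (c - 1) a)" by simp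
    then show "a = smult (inverse (c - 1)) ?X" using assms by simp
  next
    assume "a = smult (inverse (c - 1)) ?X"
    then have "smult (c - 1) a = smult (c - 1) (smult (inverse (c - 1)) ?X)" by (rule arg_cong)
    then show "smult (c - 1) a = ?X" using assms by simp
  qed
  finally show ?thesis .
qed

lemma S_series_B_plus:
  "smult (qvar ^ num_vertices (B_plus M)) (S_series (B_plus M))
      - Crls_diamond S_series (\<lambda>T. - bullet T) (B_plus M)
    = smult qvar [:1, qvar - 1:] * (\<Prod>t\<in>#M. smult (qvar ^ num_vertices t) (S_series t))
      - bullet (B_plus M)"
proof -
  define R where "R S T = smult qvar [:1, qvar - 1:]
      * (\<Prod>t\<in>#branches T. smult (qvar ^ num_vertices t) (S t)) - bullet T"
    for S :: "Qq poly tree_series" and T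
  define \<Phi> where "\<Phi> S T = smult (inverse (qvar ^ num_vertices T - 1))
      (R S T + (Crls_diamond S (\<lambda>T. - bullet T) T - S T))" for S T
  have Sigma: "[:qvar:] * Sigma_series [:qvar:] S T = smult (qvar ^ num_vertices T) (S T)"
    for S :: "Qq poly tree_series" and T
    unfolding const_mult_Sigma_series const_poly_power_mult ..
  have ex1: "\<exists>!S. \<forall>T. S T = \<Phi> S T"
  proof (rule ex1_measure_recursion[of num_vertices])
    fix S S' :: "Qq poly tree_series" and T
    assume *: "\<And>T'. num_vertices T' < num_vertices T \<Longrightarrow> S T' = S' T'"
    have "R S T = R S' T"
    proof -
      have "image_mset (\<lambda>t. smult (qvar ^ num_vertices t) (S t)) (branches T)
          = image_mset (\<lambda>t. smult (qvar ^ num_vertices t) (S' t)) (branches T)"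
        using * num_vertices_branch_less by (cases T) (auto intro!: image_mset_cong)
      then show ?thesis unfolding R_def by (simp only:)
    qed
    then show "\<Phi> S T = \<Phi> S' T"
      using Crls_diamond_lead_cong[of T S S', OF *] unfolding \<Phi>_def by (simp only:)
  qed
  have iff: "[:qvar:] * Sigma_series [:qvar:] S T - Crls_diamond S (\<lambda>T'. - bullet T') T
       = [:qvar:] * (1 + [:qvar - 1:] * xvar)
           * Crls_diamond bullet (\<lambda>T'. [:qvar:] * Sigma_series [:qvar:] S T') T
         - bullet T \<longleftrightarrow> S T = \<Phi> S T" for S T
  proof -
    have y: "[:qvar:] * (1 + [:qvar - 1:] * xvar) = smult qvar [:1, qvar - 1:]"
      by (simp add: xvar_def one_pCons)
    have "[:qvar:] * (1 + [:qvar - 1:] * xvar)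
        * Crls_diamond bullet (\<lambda>T'. [:qvar:] * Sigma_series [:qvar:] S T') T - bullet T = R S T"
      unfolding Sigma y R_def by (cases T) (simp only: Crls_diamond_bullet_left branches.simps)
    then show ?thesis
      unfolding \<Phi>_def Sigma by (simp only: smult_minus_eq_iff qvar_power_neq_1 num_vertices_pos not_False_eq_True)
  qed
  have THE_eq: "S_series = (THE S. \<forall>T. S T = \<Phi> S T)"
    unfolding S_series_def iff ..
  have "\<forall>T. S_series T = \<Phi> S_series T"
    using theI'[OF ex1] unfolding THE_eq [symmetric] .
  then have "S_series (B_plus M) = \<Phi> S_series (B_plus M)" by (rule spec)
  then have "smult (qvar ^ num_vertices (B_plus M)) (S_series (B_plus M))
      - Crls_diamond S_series (\<lambda>T. - bullet T) (B_plus M) = R S_series (B_plus M)"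
    unfolding \<Phi>_def
    by (simp only: smult_minus_eq_iff qvar_power_neq_1 num_vertices_pos not_False_eq_True)
  then show ?thesis unfolding R_def branches.simps .
qed

section \<open>Zero and difference of the coefficients of S\<close>

lemma poly_prod_mset: "poly (prod_mset M) a = prod_mset (image_mset (\<lambda>p. poly p a) M)"
  by (induction M) simp_all

text \<open>At -1/q the factor q (1 + (q - 1) x) equals 1, so the right-hand side is 1 - 1 for the
  one-vertex tree; otherwise it contains a branch that vanishes by induction.\<close>

lemma S_series_at_minus_1: "poly (S_series T) (- 1 / qvar) = 0"
proof (induction T rule: measure_induct_rule[of num_vertices])
  case (less T)
  let ?a = "- 1 / qvar"
  obtain M where T: "T = B_plus M" by (cases T)
  let ?n = "num_vertices T"
  have "additive (\<lambda>p. poly p ?a)" by unfold_locales simp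
  note hom = Crls_diamond_neg_bullet_additive[OF this]
  have "Crls_diamond (\<lambda>T. poly (S_series T) ?a) (\<lambda>T. - bullet T) T - poly (S_series T) ?a
      = Crls_diamond (\<lambda>_. 0) (\<lambda>T. - bullet T) T - 0"
    by (rule Crls_diamond_lead_cong) (rule less)
  then have C: "poly (Crls_diamond S_series (\<lambda>T. - bullet T) T) ?a = poly (S_series T) ?a"
    unfolding hom by (simp add: Crls_diamond_def)
  have y: "poly (smult qvar [:1, qvar - 1:]) ?a = 1"
    by (simp add: field_simps)
  have P: "poly (smult qvar [:1, qvar - 1:] * (\<Prod>t\<in>#M. smult (qvar ^ num_vertices t) (S_series t))
      - bullet T) ?a = 0"
  proof (cases "M = {#}")
    case True
    then show ?thesis using y T by (simp add: bullet_def)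
  next
    case False
    then obtain t where t: "t \<in># M" by blast
    then have "poly (S_series t) ?a = 0" using less[of t] num_vertices_branch_less T by simp
    then have "poly (\<Prod>t\<in>#M. smult (qvar ^ num_vertices t) (S_series t)) ?a = 0"
      using t by (auto simp: poly_prod_mset dest!: multi_member_split)
    then show ?thesis using False T by (simp add: bullet_def)
  qed
  have "(qvar ^ ?n - 1) * poly (S_series T) ?a = 0"
    using arg_cong[OF S_series_B_plus[of M, folded T], of "\<lambda>p. poly p ?a"]
    unfolding P by (simp only: poly_diff poly_smult C) (simp add: algebra_simps)
  then show ?case by simp
qed

text \<open>\<open>D\<close> is the difference and \<open>E\<close> its claimed value. Up to a fixed
  factor \<open>E\<close> is multiplicative in the branches, so its \<open>Crls_diamond\<close> is a
  product over them, while that of \<open>D\<close> comes from the equation and its shift.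
  Triangularity then leaves a nonzero multiple of \<open>D T - E T\<close>.\<close>

lemma S_series_shift:
  "shift_q (S_series (B_plus M)) - S_series (B_plus M)
    = smult qvar [:1, qvar - 1:] * shift_q (\<Prod>t\<in>#M. S_series t)"
proof -
  define y where "y = [:1, qvar - 1:]"
  define G where "G M = shift_q (\<Prod>t\<in>#M. S_series t)" for M
  define D where "D T = shift_q (S_series T) - S_series T" for T
  define E where "E T = smult qvar y * G (branches T)" for T
  have shift_y: "shift_q y = smult qvar y" unfolding y_def by (rule shift_q_linear)
  have eq: "smult (qvar ^ num_vertices (B_plus M)) (S_series (B_plus M))
      - Crls_diamond S_series (\<lambda>T. - bullet T) (B_plus M)
    = smult (qvar ^ num_vertices (B_plus M)) (y * (\<Prod>t\<in>#M. S_series t)) - bullet (B_plus M)" for M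
    unfolding S_series_B_plus prod_mset_smult_num_vertices y_def [symmetric]
    by (simp add: mult.commute[of qvar])
  have eq_shift: "smult (qvar ^ num_vertices (B_plus M)) (shift_q (S_series (B_plus M)))
      - Crls_diamond (\<lambda>T. shift_q (S_series T)) (\<lambda>T. - bullet T) (B_plus M)
    = smult (qvar ^ num_vertices (B_plus M)) (E (B_plus M)) - bullet (B_plus M)" for M
    using arg_cong[OF eq[of M], of shift_q]
    unfolding shift_q_diff shift_q_smult shift_q_mult shift_y shift_q_bullet
      Crls_diamond_neg_bullet_additive[OF additive_shift_q] E_def G_def
    by simp
  have "D T = E T" for T
  proof (induction T rule: measure_induct_rule[of num_vertices])
    case (less T)
    obtain M where T: "T = B_plus M" by (cases T)
    let ?n = "num_vertices T"
    let ?P = "\<Prod>t\<in>#M. S_series t"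
    \<comment> \<open>The shifted equation at \<open>t\<close> expresses the left side by
      \<open>shift_q (S_series t) - E t\<close>, which the induction hypothesis turns into
      \<open>S_series t\<close>.\<close>
    have branch: "- bullet t + Crls_diamond (\<lambda>T. shift_q (S_series T)) (\<lambda>T. - bullet T) t
        = smult (qvar ^ num_vertices t) (S_series t)" if t: "t \<in># M" for t
    proof -
      have "D t = E t" using less t num_vertices_branch_less T by simp
      then have "smult (qvar ^ num_vertices t) (shift_q (S_series t) - E t)
          = smult (qvar ^ num_vertices t) (S_series t)"
        by (simp add: D_def algebra_simps)
      then show ?thesis
        using eq_shift[of "branches t"]
        by (cases t) (simp add: smult_diff_right algebra_simps del: num_vertices.simps)
    qed
    have "Crls_diamond (\<lambda>T. G (branches T)) (\<lambda>T. - bullet T) T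
        = (\<Prod>t\<in>#M. - bullet t + Crls_diamond (\<lambda>T. shift_q (S_series T)) (\<lambda>T. - bullet T) t)"
      unfolding T
      by (rule Crls_diamond_B_plus) (simp add: G_def shift_q_prod_mset multiset.map_comp comp_def)
    also have "\<dots> = (\<Prod>t\<in>#M. smult (qvar ^ num_vertices t) (S_series t))"
      by (rule arg_cong[of _ _ prod_mset], rule image_mset_cong, rule branch)
    also have "\<dots> = smult (qvar ^ (?n - 1)) ?P"
      unfolding prod_mset_smult_num_vertices T ..
    finally have G: "Crls_diamond (\<lambda>T. G (branches T)) (\<lambda>T. - bullet T) T = \<dots>" .
    have "additive (\<lambda>p. smult qvar y * p)" by unfold_locales (rule distrib_left)
    from Crls_diamond_neg_bullet_additive[OF this, of "\<lambda>T. G (branches T)" T]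
    have "Crls_diamond E (\<lambda>T. - bullet T) T = smult qvar y * smult (qvar ^ (?n - 1)) ?P"
      unfolding E_def G ..
    also have "\<dots> = smult (qvar ^ ?n) (y * ?P)"
      by (simp add: power_num_vertices mult.commute[of qvar])
    finally have CE: "Crls_diamond E (\<lambda>T. - bullet T) T = \<dots>" .
    have "additive (\<lambda>p. shift_q p - p)" by unfold_locales (simp add: shift_q_add)
    from Crls_diamond_neg_bullet_additive[OF this, of S_series T]
    have "Crls_diamond D (\<lambda>T. - bullet T) T
        = shift_q (Crls_diamond S_series (\<lambda>T. - bullet T) T)
          - Crls_diamond S_series (\<lambda>T. - bullet T) T"
      unfolding D_def by simp
    also have "\<dots> = smult (qvar ^ ?n) (D T) - smult (qvar ^ ?n) (E T) + smult (qvar ^ ?n) (y * ?P)"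
      using eq[of M, folded T] eq_shift[of M, folded T]
      unfolding Crls_diamond_neg_bullet_additive[OF additive_shift_q] D_def
      by (simp add: smult_diff_right algebra_simps del: num_vertices.simps)
    finally have CD: "Crls_diamond D (\<lambda>T. - bullet T) T = \<dots>" .
    have "Crls_diamond D (\<lambda>T. - bullet T) T - D T = Crls_diamond E (\<lambda>T. - bullet T) T - E T"
      by (rule Crls_diamond_lead_cong) (rule less)
    then have "smult (qvar ^ ?n - 1) (D T - E T) = 0"
      unfolding CD CE by (simp add: smult_diff_left smult_diff_right algebra_simps)
    then show ?case by (simp add: smult_eq_0_iff)
  qed
  from this[of "B_plus M"] show ?thesis
    unfolding D_def E_def G_def y_def branches.simps .
qed

section \<open>The series Omega and its identification\<close>

lemma Omega_q_eq:
  "Crls_diamond (\<lambda>T. qvar ^ num_vertices T * Omega_q T) bullet T - Omega_q T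
    = graft_on_bullet Omega_q T + (qvar - 1) * bullet T"
proof -
  define N where "N \<Omega> = (\<lambda>T. qvar ^ num_vertices T * \<Omega> T)" for \<Omega> :: "Qq tree_series"
  \<comment> \<open>The leading term of \<open>Crls_diamond\<close> is \<open>N \<Omega> T\<close>;
    together with the subtracted \<open>\<Omega> T\<close> it yields the divisor.\<close>
  define \<Phi> where "\<Phi> \<Omega> T = (graft_on_bullet \<Omega> T + (qvar - 1) * bullet T
      - (Crls_diamond (N \<Omega>) bullet T - N \<Omega> T)) / (qvar ^ num_vertices T - 1)" for \<Omega> T
  have ex1: "\<exists>!\<Omega>. \<forall>T. \<Omega> T = \<Phi> \<Omega> T"
  proof (rule ex1_measure_recursion[of num_vertices])
    fix \<Omega> \<Omega>' :: "Qq tree_series" and T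
    assume *: "\<And>T'. num_vertices T' < num_vertices T \<Longrightarrow> \<Omega> T' = \<Omega>' T'"
    have "Crls_diamond (N \<Omega>) bullet T - N \<Omega> T = Crls_diamond (N \<Omega>') bullet T - N \<Omega>' T"
      by (rule Crls_diamond_lead_cong) (simp add: N_def *)
    then show "\<Phi> \<Omega> T = \<Phi> \<Omega>' T"
      using graft_on_bullet_cong[of T \<Omega> \<Omega>', OF *] unfolding \<Phi>_def by (simp only:)
  qed
  have iff: "Crls_diamond (\<lambda>T'. qvar * Sigma_series qvar \<Omega> T') bullet T - \<Omega> T
       = graft_on_bullet \<Omega> T + (qvar - 1) * bullet T \<longleftrightarrow> \<Omega> T = \<Phi> \<Omega> T" for \<Omega> T
  proof -
    have nz: "qvar ^ num_vertices T - 1 \<noteq> 0" by simp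
    have N: "(\<lambda>T'. qvar * Sigma_series qvar \<Omega> T') = N \<Omega>"
      unfolding N_def const_mult_Sigma_series ..
    have NT: "N \<Omega> T = qvar ^ num_vertices T * \<Omega> T" by (simp add: N_def)
    show ?thesis
      unfolding N \<Phi>_def nonzero_eq_divide_eq[OF nz] NT by (auto simp: algebra_simps)
  qed
  have THE_eq: "Omega_q = (THE \<Omega>. \<forall>T. \<Omega> T = \<Phi> \<Omega> T)"
    unfolding Omega_q_def iff ..
  have "\<forall>T. Omega_q T = \<Phi> Omega_q T"
    using theI'[OF ex1] unfolding THE_eq [symmetric] .
  then have "Omega_q T = \<Phi> Omega_q T" by (rule spec)
  then show ?thesis unfolding iff [symmetric] const_mult_Sigma_series .
qed

text \<open>Replacing q by 1/q and rescaling exchanges the two terms on the left: the argument of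
  \<open>Crls_diamond\<close> becomes \<open>Omega_bar\<close> up to sign and a constant, and the
  bare term acquires \<open>qvar ^ num_vertices T\<close>. The equation thereby takes the form of
  the one for \<open>S_series\<close>.\<close>

lemma Omega_bar_eq:
  "qvar ^ num_vertices T * Omega_bar T - Crls_diamond Omega_bar (\<lambda>T. - bullet T) T
    = qvar ^ (num_vertices T - 1) * graft_on_bullet Omega_bar T + (qvar - 1) * bullet T"
proof -
  define J where "J T = invert_q (Omega_q T)" for T
  define r where "r = 1 / qvar"
  have r: "r * qvar = 1" "r \<noteq> 0" by (simp_all add: r_def)
  let ?n = "num_vertices T"
  have bar: "Omega_bar T = (- r) ^ (num_vertices T - 1) * J T" for T
    by (simp add: Omega_bar_def Sigma_series_def J_def r_def)
  have J: "r ^ num_vertices T * J T = - r * ((- 1) ^ num_vertices T * Omega_bar T)" for T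
    by (cases "num_vertices T")
      (use num_vertices_pos[of T] in \<open>auto simp: bar power_minus[of r] algebra_simps simp flip: power_add mult_2\<close>)
  have "invert_q (graft_on_bullet Omega_q T) = graft_on_bullet J T"
    by (simp add: graft_on_bullet_def J_def)
  moreover have "invert_q ((qvar - 1) * bullet T) = (r - 1) * bullet T"
    by (simp add: bullet_def r_def additive.diff[OF additive_invert_q])
  moreover have "invert_q (qvar ^ num_vertices T * Omega_q T)
      = - r * ((- 1) ^ num_vertices T * Omega_bar T)" for T
    unfolding J [symmetric] by (simp add: invert_q_mult invert_q_power J_def r_def)
  ultimately have "Crls_diamond (\<lambda>T. - r * ((- 1) ^ num_vertices T * Omega_bar T)) bullet T - J T
      = graft_on_bullet J T + (r - 1) * bullet T"
    using arg_cong[OF Omega_q_eq[of T], of invert_q]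
    unfolding additive.diff[OF additive_invert_q] invert_q_add
      Crls_diamond_bullet_additive[OF additive_invert_q] J_def [symmetric] by simp
  moreover have "Crls_diamond (\<lambda>T. - r * ((- 1) ^ num_vertices T * Omega_bar T)) bullet T
      = - r * ((- 1) ^ ?n * Crls_diamond Omega_bar (\<lambda>T. - bullet T) T)"
  proof -
    have "additive (\<lambda>x. - r * x)" by unfold_locales (simp add: algebra_simps)
    from Crls_diamond_bullet_additive[OF this, symmetric]
    have "Crls_diamond (\<lambda>T. - r * ((- 1) ^ num_vertices T * Omega_bar T)) bullet T
        = - r * Crls_diamond (\<lambda>T. (- 1) ^ num_vertices T * Omega_bar T) bullet T" .
    also have "Crls_diamond (\<lambda>T. (- 1) ^ num_vertices T * Omega_bar T) bullet T
        = (- 1) ^ ?n * Crls_diamond Omega_bar (\<lambda>T. - bullet T) T"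
      \<comment> \<open>The choice -1 changes \<open>bullet\<close> into \<open>- bullet\<close>,
        and the two sign factors on \<open>Omega_bar\<close> cancel.\<close>
      using Crls_diamond_scale_bullet[of "- 1" "\<lambda>T. (- 1) ^ num_vertices T * Omega_bar T" T]
      by (simp flip: mult.assoc power_mult_distrib)
    finally show ?thesis .
  qed
  ultimately have main: "- r * ((- 1) ^ ?n * Crls_diamond Omega_bar (\<lambda>T. - bullet T) T)
      = J T + graft_on_bullet J T + (r - 1) * bullet T"
    by (simp add: algebra_simps)
  have sq: "(- 1) ^ ?n * ((- 1) ^ ?n * x) = x" for x :: Qq
    by (simp flip: mult.assoc power_mult_distrib)
  have "(- 1) ^ ?n * - qvar * (- r * ((- 1) ^ ?n * Crls_diamond Omega_bar (\<lambda>T. - bullet T) T))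
      = (qvar * r) * ((- 1) ^ ?n * ((- 1) ^ ?n * Crls_diamond Omega_bar (\<lambda>T. - bullet T) T))"
    by (simp only: mult_minus_left mult_minus_right minus_minus mult_ac)
  also have "\<dots> = Crls_diamond Omega_bar (\<lambda>T. - bullet T) T"
    unfolding sq using r by (simp add: mult.commute)
  finally have "Crls_diamond Omega_bar (\<lambda>T. - bullet T) T
      = (- 1) ^ ?n * - qvar * (J T + graft_on_bullet J T + (r - 1) * bullet T)"
    unfolding main ..
  also have "\<dots> = (- 1) ^ ?n * - qvar * J T + (- 1) ^ ?n * - qvar * graft_on_bullet J T
      + (- 1) ^ ?n * - qvar * ((r - 1) * bullet T)"
    by (simp only: distrib_left)
  also have "(- 1) ^ ?n * - qvar * J T = qvar ^ ?n * Omega_bar T"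
  proof -
    have "qvar ^ ?n * Omega_bar T = qvar * ((qvar * - r) ^ (?n - 1) * J T)"
      unfolding bar power_mult_distrib by (simp add: power_num_vertices)
    also have "qvar * - r = - 1" using r by (simp add: mult.commute)
    finally show ?thesis by (simp add: power_num_vertices)
  qed
  also have "(- 1) ^ ?n * - qvar * graft_on_bullet J T
      = - (qvar ^ (?n - 1) * graft_on_bullet Omega_bar T)"
  proof (cases "\<exists>t. T = B_plus {#t#}")
    case True
    then obtain t where t: "T = B_plus {#t#}" by blast
    then have n: "?n = Suc (num_vertices t)" by simp
    have "qvar ^ num_vertices t * Omega_bar t = qvar * ((qvar * - r) ^ (num_vertices t - 1) * J t)"
      unfolding bar power_mult_distrib by (simp add: power_num_vertices)
    also have "qvar * - r = - 1" using r by (simp add: mult.commute)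
    finally show ?thesis using t unfolding n by (simp add: power_num_vertices)
  qed (simp add: graft_on_bullet_def)
  also have "(- 1) ^ ?n * - qvar * ((r - 1) * bullet T) = - ((qvar - 1) * bullet T)"
    using r by (simp add: bullet_def algebra_simps)
  finally show ?thesis by (simp add: algebra_simps)
qed

lemma deriv_at_minus_1_mult:
  "deriv_at_minus_1 (p * r) = deriv_at_minus_1 p * poly r (- 1 / qvar)
     + poly p (- 1 / qvar) * deriv_at_minus_1 r"
  by (simp add: deriv_at_minus_1_def pderiv_mult add_divide_distrib algebra_simps)

lemma deriv_at_minus_1_smult: "deriv_at_minus_1 (smult c p) = c * deriv_at_minus_1 p"
  by (simp add: deriv_at_minus_1_def pderiv_smult)

text \<open>All \<open>S_series t\<close> vanish at -1/q, so the product rule leaves only trees with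
  at most one branch: a single branch gives the grafting term, and no branch gives the derivative q
  (q - 1) of the prefactor, divided by q.\<close>

lemma deriv_at_minus_1_S_series_eq:
  fixes Z :: "Qq tree_series"
  defines "Z \<equiv> \<lambda>T. deriv_at_minus_1 (S_series T)"
  shows "qvar ^ num_vertices T * Z T - Crls_diamond Z (\<lambda>T. - bullet T) T
    = qvar ^ (num_vertices T - 1) * graft_on_bullet Z T + (qvar - 1) * bullet T"
proof -
  obtain M where T: "T = B_plus M" by (cases T)
  let ?D = deriv_at_minus_1
  let ?y = "[:1, qvar - 1:]"
  let ?P = "\<Prod>t\<in>#M. S_series t"
  have y: "poly (smult qvar ?y) (- 1 / qvar) = 1" by (simp add: field_simps)
  have Dy: "?D (smult qvar ?y) = qvar - 1"
    by (simp add: deriv_at_minus_1_def pderiv_pCons pderiv_smult)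
  have D_bullet: "?D (bullet T) = 0" by (simp add: bullet_def deriv_at_minus_1_def)
  have "qvar ^ num_vertices T * Z T - Crls_diamond Z (\<lambda>T. - bullet T) T
      = ?D (smult qvar ?y * smult (qvar ^ (num_vertices T - 1)) ?P)"
    using arg_cong[OF S_series_B_plus[of M], of ?D]
    unfolding prod_mset_smult_num_vertices T [symmetric] additive.diff[OF additive_deriv_at_minus_1]
      Crls_diamond_neg_bullet_additive[OF additive_deriv_at_minus_1]
      deriv_at_minus_1_smult D_bullet Z_def diff_0_right .
  also have "\<dots> = qvar ^ (num_vertices T - 1) * ((qvar - 1) * poly ?P (- 1 / qvar) + ?D ?P)"
    unfolding deriv_at_minus_1_mult y Dy
    by (simp add: deriv_at_minus_1_smult algebra_simps)
  also have "\<dots> = qvar ^ (num_vertices T - 1) * graft_on_bullet Z T + (qvar - 1) * bullet T"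
  proof (cases M)
    case empty
    then show ?thesis using T
      by (simp add: graft_on_bullet_def bullet_def deriv_at_minus_1_def)
  next
    case (add t M')
    show ?thesis
    proof (cases M')
      case empty
      then show ?thesis using add T
        by (simp add: bullet_def Z_def S_series_at_minus_1 [simplified] del: num_vertices.simps)
    next
      \<comment> \<open>With two or more branches every summand of the product rule keeps a factor
        that vanishes at -1/q.\<close>
      case (add t' M'')
      then show ?thesis using \<open>M = _\<close> T
        by (simp add: bullet_def graft_on_bullet_def S_series_at_minus_1 [simplified] deriv_at_minus_1_mult
            del: num_vertices.simps)
    qed
  qed
  finally show ?thesis .
qed

lemma Omega_bar_eq_deriv: "Omega_bar T = deriv_at_minus_1 (S_series T)"
proof (induction T rule: measure_induct_rule[of num_vertices])
  case (less T)
  let ?Z = "\<lambda>T. deriv_at_minus_1 (S_series T)"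
  have "Crls_diamond Omega_bar (\<lambda>T. - bullet T) T - Omega_bar T
      = Crls_diamond ?Z (\<lambda>T. - bullet T) T - ?Z T"
    by (rule Crls_diamond_lead_cong) (rule less)
  moreover have "graft_on_bullet Omega_bar T = graft_on_bullet ?Z T"
    by (rule graft_on_bullet_cong) (rule less)
  ultimately have "(qvar ^ num_vertices T - 1) * Omega_bar T = (qvar ^ num_vertices T - 1) * ?Z T"
    using Omega_bar_eq[of T] deriv_at_minus_1_S_series_eq[of T]
    by (simp add: algebra_simps)
  then show ?case by simp
qed

theorem mainTheorem6:
  fixes Ts :: "rtree list" and T :: rtree
  assumes "T = B_plus (mset Ts)"
  shows "Omega_bar (B_plus {#T#}) = Psi (- xvar * (\<Prod>i<length Ts. S_series (Ts ! i)))"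
proof -
  have "(\<Prod>t\<in>#mset Ts. S_series t) = (\<Prod>i<length Ts. S_series (Ts ! i))"
    by (induction Ts) (simp_all add: prod.lessThan_Suc_shift del: prod.lessThan_Suc)
  then have T: "shift_q (S_series T) - S_series T
      = smult qvar [:1, qvar - 1:] * shift_q (\<Prod>i<length Ts. S_series (Ts ! i))"
    using S_series_shift[of "mset Ts"] assms by simp
  have "Omega_bar (B_plus {#T#}) = deriv_at_minus_1 (S_series (B_plus {#T#}))"
    by (rule Omega_bar_eq_deriv)
  \<comment> \<open>The difference formula is used one level up, for \<open>B_plus {#T#}\<close>,
    whose branch product is \<open>S_series T\<close>; the next step uses it for \<open>T\<close>
    itself.\<close>
  also have "\<dots> = Psi (S_series T)"
    by (rule Psi_eq_deriv_at_minus_1 [symmetric]) (simp add: S_series_shift)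
  also have "\<dots> = Psi (- xvar * (\<Prod>i<length Ts. S_series (Ts ! i)))"
    by (rule Psi_by_parts[OF T S_series_at_minus_1])
  finally show ?thesis .
qed

end
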